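(* Let $k\ge 2$, $\boldsymbol{\alpha}=(\alpha_1,\dots,\alpha_k)\in(0,+\infty)^k$, $\alpha_0=\sum_{i=1}^k\alpha_i$, and let $\mathbf{X}_n=(X_{1n},\dots,X_{kn})$, $n\in[N]$, be a random sample from the Dirichlet distribution $\mathcal{D}_k(\boldsymbol{\alpha})$. The Moment Estimator $$\tilde\alpha_i=\frac{\overline{X_i}\,(\overline{X_i}-\overline{X_i^2})}{\overline{X_i^2}-\overline{X_i}^2},\qquad i\in[k],$$ is a moment-type estimator of $\boldsymbol{\alpha}$ with functions $$h(\mathbf{x})=(x_1,\dots,x_k,x_1^2,\dots,x_k^2),\qquad g_i(\mathbf{y})=\frac{y_i(y_i-y_{k+i})}{y_{k+i}-y_i^2},\quad i\in[k].$$ Its asymptotic variance-covariance matrix is $\mathbf{G}\mathbf{V}\mathbf{G}^\top$, where $\mathbf{V}=v_h(\boldsymbol{\alpha})$ is the $2k\times 2k$ variance-covariance matrix of $h(\mathbf{X})$, $\mathbf{X}\sim\mathcal{D}_k(\boldsymbol{\alpha})$, and $\mathbf{G}=[\,\mathbf{G}_1\ \ \mathbf{G}_2\,]$ is a $k\times 2k$ matrix whose $k\times k$ blocks $\mathbf{G}_1,\mathbf{G}_2$ are diagonal with, for $i\in[k]$, $$(\mathbf{G}_1)_{ii}=\frac{\alpha_0}{\alpha_0-\alpha_i}(2\alpha_0+1)(\alpha_i+1),\qquad (\mathbf{G}_2)_{ii}=-\frac{\alpha_0}{\alpha_0-\alpha_i}(\alpha_0+1)^2.$$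
   Context: Notation: $[k]=\{1,\dots,k\}$; a random sample is an i.i.d. sample; $\overline{h(\mathbf{X})}:=\frac1N\sum_{n=1}^N h(\mathbf{X}_n)$, so $\overline{X_i}=\frac1N\sum_n X_{in}$ and $\overline{X_i^2}=\frac1N\sum_n X_{in}^2$. $e_h(\boldsymbol{\theta})=\mathbb{E}_{\boldsymbol{\theta}}(h(\mathbf{X}))$ and $v_h(\boldsymbol{\theta})=\mathbb{V}_{\boldsymbol{\theta}}(h(\mathbf{X}))$ (variance-covariance matrix). Dirichlet distribution: $\mathbf{X}\sim\mathcal{D}_k(\boldsymbol{\alpha})$ has density, with respect to Lebesgue measure on $\mathbb{R}^{k-1}$ (using the first $k-1$ coordinates), $f(\mathbf{x};\boldsymbol{\alpha})=\frac{\Gamma(\alpha_0)}{\prod_{i=1}^k\Gamma(\alpha_i)}\prod_{i=1}^k x_i^{\alpha_i-1}$ on the open simplex $\{\mathbf{x}\in(0,1)^k:\sum_i x_i=1\}$. Moment-type estimator: for a parametric family with support $\mathbf{S}\subset\mathbb{R}^k$ and parameter space $\boldsymbol{\Theta}\subset\mathbb{R}^d$, let $h:\mathbf{S}\to\mathbb{R}^m$ be such that $e_h:\boldsymbol{\Theta}\to\mathbb{R}^m$ is injective, and let $g:\mathbb{R}^m\to\mathbb{R}^d$ satisfy $g|_{e_h(\boldsymbol{\Theta})}=e_h^{-1}$. The estimator $\tilde{\boldsymbol{\theta}}_N=g(\overline{h(\mathbf{X})})$ is called a moment-type estimator of $\boldsymbol{\theta}$ (with functions $h,g$); it exists as long as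 $\tilde{\boldsymbol{\theta}}_N\in\boldsymbol{\Theta}$. A function $g$ given by a formula is understood to be defined arbitrarily where the formula is undefined. An estimator $\tilde{\boldsymbol{\theta}}_N$ that exists with probability tending to 1 as $N\to\infty$ has asymptotic variance-covariance matrix $\boldsymbol{\Sigma}$ if $\sqrt{N}(\tilde{\boldsymbol{\theta}}_N-\boldsymbol{\theta})$ converges in law, under $\boldsymbol{\theta}$, to the centered normal distribution with covariance matrix $\boldsymbol{\Sigma}$ as $N\to\infty$. *)

theory Defs
  imports "HOL-Probability.Probability"
begin

section \<open>The Dirichlet distribution\<close>

text \<open>
  Vectors in \<open>\<real>\<^sup>k\<close> are of type \<open>real ^ 'k\<close> with \<open>'k\<close> finite and linearly ordered, so that \<open>'k\<close> is
  order-isomorphic to \<open>{1..k}\<close> with \<open>k = CARD('k)\<close>. The first \<open>k - 1\<close> coordinates are those different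
  from \<open>Max UNIV\<close>.
\<close>

definition simplex_point ::
    "('k::{finite,linorder} \<Rightarrow> real) \<Rightarrow> real ^ ('k::{finite,linorder})" where
  "simplex_point x = (\<chi> i. if i = Max UNIV then 1 - (\<Sum>j | j \<noteq> Max UNIV. x j) else x i)"

definition open_simplex :: "(real ^ 'k) set" where
  "open_simplex = {x. (\<forall>i. 0 < x $ i \<and> x $ i < 1) \<and> (\<Sum>i\<in>UNIV. x $ i) = 1}"

definition dirichlet_density :: "real ^ 'k \<Rightarrow> real ^ 'k \<Rightarrow> real" where
  "dirichlet_density \<alpha> x =
     (if x \<in> open_simplex
      then Gamma (\<Sum>i\<in>UNIV. \<alpha> $ i) / (\<Prod>i\<in>UNIV. Gamma (\<alpha> $ i)) * (\<Prod>i\<in>UNIV. x $ i powr (\<alpha> $ i - 1))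
      else 0)"

text \<open>
  The density is taken with respect to Lebesgue measure in the first \<open>k - 1\<close> coordinates; the result
  is transported to a measure on \<open>\<real>\<^sup>k\<close> by recovering the last coordinate.
\<close>

definition dirichlet ::
    "real ^ ('k::{finite,linorder}) \<Rightarrow> (real ^ ('k::{finite,linorder})) measure" where
  "dirichlet \<alpha> =
     distr (density (PiM {i. i \<noteq> Max UNIV} (\<lambda>_. lborel))
                    (\<lambda>x. ennreal (dirichlet_density \<alpha> (simplex_point x))))
           borel simplex_point"

definition dirichlet_params :: "(real ^ 'k) set" where
  "dirichlet_params = {\<alpha>. \<forall>i. 0 < \<alpha> $ i}"


section \<open>Random samples and moment-type estimators\<close>

text \<open>Samples are indexed from 1; a sample of size \<open>N\<close> consists of the first \<open>N\<close> terms.\<close>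

definition random_sample :: "'a measure \<Rightarrow> 'b::topological_space measure \<Rightarrow> (nat \<Rightarrow> 'a \<Rightarrow> 'b) \<Rightarrow> bool" where
  "random_sample M P X \<longleftrightarrow>
     prob_space M \<and>
     prob_space.indep_vars M (\<lambda>_. borel) X {1..} \<and>
     (\<forall>n\<ge>1. distr M borel (X n) = P)"

definition sample_mean :: "nat \<Rightarrow> (nat \<Rightarrow> 'b::real_vector) \<Rightarrow> 'b" where
  "sample_mean N y = (\<Sum>n=1..N. y n) /\<^sub>R real N"

definition moment_map ::
    "('p \<Rightarrow> 'x measure) \<Rightarrow> ('x \<Rightarrow> 'y::{banach,second_countable_topology}) \<Rightarrow> 'p \<Rightarrow> 'y" where
  "moment_map P h \<theta> = (\<integral>x. h x \<partial>P \<theta>)"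

definition covariance_matrix :: "'x measure \<Rightarrow> ('x \<Rightarrow> real ^ 'm) \<Rightarrow> real ^ 'm ^ 'm" where
  "covariance_matrix P h =
     (\<chi> i j. \<integral>x. (h x $ i - (\<integral>z. h z $ i \<partial>P)) * (h x $ j - (\<integral>z. h z $ j \<partial>P)) \<partial>P)"

text \<open>
  An estimator maps the sample size and the observations to an estimate; only the observations with
  indices \<open>1, \<dots>, N\<close> are relevant.
\<close>

definition moment_type_estimator ::
    "('p \<Rightarrow> 'x measure) \<Rightarrow> 'p set \<Rightarrow> ('x \<Rightarrow> 'y::{banach,second_countable_topology}) \<Rightarrow> ('y \<Rightarrow> 'p)
      \<Rightarrow> (nat \<Rightarrow> (nat \<Rightarrow> 'x) \<Rightarrow> 'p) \<Rightarrow> bool" where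
  "moment_type_estimator P \<Theta> h g T \<longleftrightarrow>
     (\<forall>\<theta>\<in>\<Theta>. integrable (P \<theta>) h) \<and>
     inj_on (moment_map P h) \<Theta> \<and>
     (\<forall>y\<in>moment_map P h ` \<Theta>. g y = the_inv_into \<Theta> (moment_map P h) y) \<and>
     (\<forall>N\<ge>1. \<forall>x. T N x = g (sample_mean N (\<lambda>n. h (x n))))"


section \<open>Asymptotic variance-covariance matrices\<close>

definition converges_in_law ::
    "(nat \<Rightarrow> 'b::topological_space measure) \<Rightarrow> 'b measure \<Rightarrow> bool" where
  "converges_in_law \<mu> \<nu> \<longleftrightarrow>
     (\<forall>f::'b \<Rightarrow> real. continuous_on UNIV f \<longrightarrow> bounded (range f) \<longrightarrow>
        (\<lambda>n. \<integral>x. f x \<partial>\<mu> n) \<longlonglongrightarrow> (\<integral>x. f x \<partial>\<nu>))"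

text \<open>
  The multivariate normal law, characterised by its one-dimensional projections so that singular
  covariance matrices are covered. A matrix that is not positive semidefinite is excluded
  explicitly, since \<^const>\<open>sqrt\<close> is also defined on negative numbers.
\<close>

definition centered_normal_real :: "real \<Rightarrow> real measure" where
  "centered_normal_real v =
     (if v = 0 then return borel 0 else density lborel (\<lambda>x. ennreal (normal_density 0 (sqrt v) x)))"

definition centered_normal :: "real ^ 'n ^ 'n \<Rightarrow> (real ^ 'n) measure \<Rightarrow> bool" where
  "centered_normal C \<nu> \<longleftrightarrow>
     transpose C = C \<and> (\<forall>t. 0 \<le> t \<bullet> (C *v t)) \<and>
     sets \<nu> = sets borel \<and>
     (\<forall>t. distr \<nu> borel (\<lambda>x. t \<bullet> x) = centered_normal_real (t \<bullet> (C *v t)))"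

definition asymptotic_covariance ::
    "'a measure \<Rightarrow> (nat \<Rightarrow> 'a \<Rightarrow> 'x) \<Rightarrow> (real ^ 'd) set \<Rightarrow> (nat \<Rightarrow> (nat \<Rightarrow> 'x) \<Rightarrow> real ^ 'd)
      \<Rightarrow> real ^ 'd \<Rightarrow> real ^ 'd ^ 'd \<Rightarrow> bool" where
  "asymptotic_covariance M X \<Theta> T \<theta> C \<longleftrightarrow>
     (let T' = (\<lambda>N \<omega>. T N (\<lambda>n. X n \<omega>)) in
       (\<forall>N\<ge>1. T' N \<in> borel_measurable M) \<and>
       (\<lambda>N. measure M {\<omega> \<in> space M. T' N \<omega> \<in> \<Theta>}) \<longlonglongrightarrow> 1 \<and>
       (\<exists>\<nu>. centered_normal C \<nu> \<and>
            converges_in_law (\<lambda>N. distr M borel (\<lambda>\<omega>. sqrt (real N) *\<^sub>R (T' N \<omega> - \<theta>))) \<nu>))"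


section \<open>The moment estimator of the Dirichlet parameters\<close>

text \<open>
  Vectors in \<open>\<real>\<^sup>2\<^sup>k\<close> are indexed by \<open>'k + 'k\<close>: \<open>Inl i\<close> stands for \<open>i\<close>, \<open>Inr i\<close> for \<open>k + i\<close>.
  The quotients below take the value \<open>0\<close> where their denominator vanishes.
\<close>

definition moment_estimator :: "nat \<Rightarrow> (nat \<Rightarrow> real ^ 'k) \<Rightarrow> real ^ 'k" where
  "moment_estimator N x =
     (\<chi> i. let m1 = sample_mean N (\<lambda>n. x n $ i); m2 = sample_mean N (\<lambda>n. (x n $ i)\<^sup>2)
           in m1 * (m1 - m2) / (m2 - m1\<^sup>2))"

definition mom_h :: "real ^ 'k \<Rightarrow> real ^ ('k + 'k)" where
  "mom_h x = (\<chi> j. case j of Inl i \<Rightarrow> x $ i | Inr i \<Rightarrow> (x $ i)\<^sup>2)"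

definition mom_g :: "real ^ ('k + 'k) \<Rightarrow> real ^ 'k" where
  "mom_g y = (\<chi> i. y $ Inl i * (y $ Inl i - y $ Inr i) / (y $ Inr i - (y $ Inl i)\<^sup>2))"

definition mom_G :: "real ^ 'k \<Rightarrow> real ^ ('k + 'k) ^ 'k" where
  "mom_G \<alpha> =
     (let \<alpha>0 = (\<Sum>i\<in>UNIV. \<alpha> $ i) in
      \<chi> i j. case j of
          Inl l \<Rightarrow> if l = i then \<alpha>0 / (\<alpha>0 - \<alpha> $ i) * (2 * \<alpha>0 + 1) * (\<alpha> $ i + 1) else 0
        | Inr l \<Rightarrow> if l = i then - (\<alpha>0 / (\<alpha>0 - \<alpha> $ i) * (\<alpha>0 + 1)\<^sup>2) else 0)"

end

theory Submission
  imports Defs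
begin

text \<open>
  The theorem is an instance of the delta method. Write \<open>A\<close> for the sum of the parameters. Under
  \<open>\<D>(\<alpha>)\<close> the coordinate \<open>x\<^sub>i\<close> has mean \<open>u = \<alpha>\<^sub>i / A\<close> and second moment
  \<open>v = \<alpha>\<^sub>i (\<alpha>\<^sub>i + 1) / (A (A + 1))\<close>, and elementary algebra gives \<open>u (u - v) / (v - u\<^sup>2) = \<alpha>\<^sub>i\<close>,
  where the denominator is the variance of the coordinate and hence positive. So \<^const>\<open>mom_g\<close> is a left
  inverse of the moment map, which makes the latter injective, and the estimator is
  \<^const>\<open>mom_g\<close> applied to the sample mean of \<^const>\<open>mom_h\<close>. The matrix \<^const>\<open>mom_G\<close> is the Jacobian of
  \<^const>\<open>mom_g\<close> at the moments of \<open>\<alpha>\<close>, and a linear map \<open>G\<close> turns a normal law with covariance \<open>V\<close>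
  into one with covariance \<open>G V G\<^sup>T\<close>.
  
  The moments follow from the Dirichlet integral: multiplying the density by \<open>x\<^sub>i ^ m\<close> amounts to raising
  \<open>\<alpha>\<^sub>i\<close> by \<open>m\<close>, so every moment is a quotient of two normalising constants
  (\<open>nn_integral_dirichlet_power\<close>). The normalising constant is computed coordinate by coordinate, each
  step being a Beta integral (\<open>nn_integral_dirichlet_kernel\<close>).
  
  Convergence in law in several dimensions is reduced to the univariate central limit theorem.
  Integrals of all waves \<open>cos (t \<bullet> x + b)\<close> together with tightness determine the limit
  (\<open>converges_in_law_if_cos\<close>), because by Stone--Weierstrass sums of such waves approximate every bounded
  continuous function uniformly on balls without exceeding its bound by more than the error. A wave sees
  only the projection of its argument on \<open>t\<close>, so the univariate theorem yields its limit
  (\<open>clt_expectation_cos\<close>); the remainder of the linearisation tends to \<open>0\<close> in probability by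
  Chebyshev's inequality and changes the expectation of a wave by a vanishing amount (\<open>delta_method\<close>).
  The limiting normal law, possibly singular, is the image of independent standard normal variables
  under a factor of the covariance matrix (\<open>ex_centered_normal\<close>).
\<close>

section \<open>The Dirichlet integral\<close>

text \<open>
  The power function cut off to \<open>0\<close> on the nonpositive reals. It encodes membership in the open simplex
  inside the integrand, so that all integrals run over the whole space and Tonelli's theorem applies
  without bookkeeping of domains.
\<close>

definition pos_powr :: "real \<Rightarrow> real \<Rightarrow> real" where
  "pos_powr x p = (if 0 < x then x powr p else 0)"

lemma pos_powr_nonneg [simp]: "0 \<le> pos_powr x p"
  by (simp add: pos_powr_def)

lemma pos_powr_measurable [measurable]:
  assumes [measurable]: "f \<in> borel_measurable M"
  shows "(\<lambda>x. pos_powr (f x) p) \<in> borel_measurable M"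
  unfolding pos_powr_def by measurable

lemma pos_powr_mult: "0 < s \<Longrightarrow> pos_powr (s * x) p = s powr p * pos_powr x p"
  by (auto simp: pos_powr_def powr_mult zero_less_mult_iff)

text \<open>
  The substitution \<open>x = s y\<close> reduces this to the Beta integral. Having it for every \<open>s\<close>, including
  \<open>s \<le> 0\<close> where both sides vanish, is what lets the next induction integrate out one variable at a time.
\<close>

lemma nn_integral_beta_convolution:
  assumes "0 < a" "0 < b"
  shows "(\<integral>\<^sup>+x. ennreal (pos_powr x (a - 1) * pos_powr (s - x) (b - 1)) \<partial>lborel)
           = ennreal (Beta a b * pos_powr s (a + b - 1))"
proof (cases "0 < s")
  case False
  have *: "pos_powr x (a - 1) * pos_powr (s - x) (b - 1) = 0" for x
    using False by (auto simp: pos_powr_def)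
  from False show ?thesis by (simp add: *) (simp add: pos_powr_def)
next
  case True
  have B: "(\<integral>\<^sup>+x. ennreal (pos_powr x (a - 1) * pos_powr (1 - x) (b - 1)) \<partial>lborel) = ennreal (Beta a b)"
    (is "?L = _")
  proof -
    have "?L = (\<integral>\<^sup>+x. ennreal (indicator {0..1} x * (x powr (a - 1) * (1 - x) powr (b - 1))) \<partial>lborel)"
    proof (rule nn_integral_cong, goal_cases)
      case (1 x)
      show ?case
        by (cases "x = 0"; cases "x = 1") (auto simp: pos_powr_def indicator_def)
    qed
    also have "\<dots> = ennreal (Beta a b)"
      by (rule nn_integral_has_integral_lebesgue[OF _ has_integral_Beta_real[OF assms]]) auto
    finally show ?thesis .
  qed
  have "(\<integral>\<^sup>+x. ennreal (pos_powr x (a - 1) * pos_powr (s - x) (b - 1)) \<partial>lborel)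
     = ennreal \<bar>s\<bar> * (\<integral>\<^sup>+x. ennreal (pos_powr (0 + s * x) (a - 1) * pos_powr (s - (0 + s * x)) (b - 1)) \<partial>lborel)"
    by (rule nn_integral_real_affine) (use True in auto)
  also have "(\<lambda>x. pos_powr (0 + s * x) (a - 1) * pos_powr (s - (0 + s * x)) (b - 1))
       = (\<lambda>x. s powr (a + b - 2) * (pos_powr x (a - 1) * pos_powr (1 - x) (b - 1)))"
  proof
    fix x
    have "s - (0 + s * x) = s * (1 - x)" by (simp add: algebra_simps)
    moreover have "s powr (a - 1) * s powr (b - 1) = s powr (a + b - 2)"
      by (simp add: powr_add[symmetric])
    ultimately show "pos_powr (0 + s * x) (a - 1) * pos_powr (s - (0 + s * x)) (b - 1)
        = s powr (a + b - 2) * (pos_powr x (a - 1) * pos_powr (1 - x) (b - 1))"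
      using True by (simp add: pos_powr_mult mult_ac)
  qed
  also have "(\<integral>\<^sup>+x. ennreal (s powr (a + b - 2) * (pos_powr x (a - 1) * pos_powr (1 - x) (b - 1))) \<partial>lborel)
     = ennreal (s powr (a + b - 2)) * ennreal (Beta a b)"
    by (simp add: ennreal_mult' nn_integral_cmult B[unfolded ennreal_mult'[OF pos_powr_nonneg]])
  also have "ennreal \<bar>s\<bar> * \<dots> = ennreal (s * s powr (a + b - 2) * Beta a b)"
    using True by (simp add: ennreal_mult' ennreal_mult'' mult_ac)
  also have "s * s powr (a + b - 2) = pos_powr s (a + b - 1)"
    using True powr_add[of s 1 "a + b - 2"] by (simp add: pos_powr_def)
  finally show ?thesis by (simp add: mult_ac)
qed

text \<open>
  Induction on \<open>I\<close>, integrating over the new variable \<open>y\<close> last: with \<open>y\<close> fixed, the inner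
  integral is the same problem with total mass \<open>s - y\<close>, and its value, a power of \<open>s - y\<close>, is then
  convolved with the power of \<open>y\<close>. The product of Gamma functions telescopes through
  \<open>\<Gamma>(a) \<Gamma>(b) = B(a, b) \<Gamma>(a + b)\<close>.
\<close>

lemma nn_integral_dirichlet_kernel:
  assumes "finite I" "\<And>i. i \<in> I \<Longrightarrow> 0 < a i" "0 < b"
  shows "(\<integral>\<^sup>+x. ennreal ((\<Prod>i\<in>I. pos_powr (x i) (a i - 1)) * pos_powr (s - (\<Sum>i\<in>I. x i)) (b - 1))
            \<partial>PiM I (\<lambda>_. lborel))
         = ennreal ((\<Prod>i\<in>I. Gamma (a i)) * Gamma b / Gamma ((\<Sum>i\<in>I. a i) + b)
              * pos_powr s ((\<Sum>i\<in>I. a i) + b - 1))"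
  using assms(1,2)
proof (induction I arbitrary: s rule: finite_induct)
  case empty
  interpret product_sigma_finite "\<lambda>_. lborel :: real measure" ..
  show ?case using Gamma_real_pos[OF assms(3)] by (simp add: PiM_empty nn_integral_count_space_finite)
next
  case (insert j I)
  interpret product_sigma_finite "\<lambda>_. lborel :: real measure" ..
  define A where "A = (\<Sum>i\<in>I. a i)"
  define C where "C = (\<Prod>i\<in>I. Gamma (a i)) * Gamma b / Gamma (A + b)"
  have aj: "a j > 0" and aI: "\<And>i. i \<in> I \<Longrightarrow> a i > 0" using insert.prems by auto
  have "A \<ge> 0" unfolding A_def by (intro sum_nonneg less_imp_le aI)
  then have A: "A + b > 0" using assms(3) by simp
  have C0: "C \<ge> 0"
    unfolding C_def
    by (intro divide_nonneg_pos mult_nonneg_nonneg prod_nonneg less_imp_le Gamma_real_pos A aI assms(3))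
  have "(\<integral>\<^sup>+x. ennreal ((\<Prod>i\<in>insert j I. pos_powr (x i) (a i - 1)) * pos_powr (s - (\<Sum>i\<in>insert j I. x i)) (b - 1))
            \<partial>PiM (insert j I) (\<lambda>_. lborel))
    = (\<integral>\<^sup>+y. \<integral>\<^sup>+x. ennreal ((\<Prod>i\<in>insert j I. pos_powr ((x(j := y)) i) (a i - 1)) *
           pos_powr (s - (\<Sum>i\<in>insert j I. (x(j := y)) i)) (b - 1)) \<partial>PiM I (\<lambda>_. lborel) \<partial>lborel)"
    by (rule product_nn_integral_insert_rev) (use insert in auto)
  also have "\<dots> = (\<integral>\<^sup>+y. \<integral>\<^sup>+x. ennreal (pos_powr y (a j - 1)) *
       ennreal ((\<Prod>i\<in>I. pos_powr (x i) (a i - 1)) * pos_powr (s - y - (\<Sum>i\<in>I. x i)) (b - 1)) \<partial>PiM I (\<lambda>_. lborel) \<partial>lborel)"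
  proof (intro nn_integral_cong, goal_cases)
    case (1 y x)
    have "(\<Prod>i\<in>I. pos_powr ((x(j := y)) i) (a i - 1)) = (\<Prod>i\<in>I. pos_powr (x i) (a i - 1))"
      "(\<Sum>i\<in>I. (x(j := y)) i) = (\<Sum>i\<in>I. x i)"
      using insert by (auto intro!: prod.cong sum.cong)
    then show ?case using insert by (simp add: ennreal_mult' mult_ac algebra_simps)
  qed
  also have "\<dots> = (\<integral>\<^sup>+y. ennreal (pos_powr y (a j - 1)) *
       (\<integral>\<^sup>+x. ennreal ((\<Prod>i\<in>I. pos_powr (x i) (a i - 1)) * pos_powr (s - y - (\<Sum>i\<in>I. x i)) (b - 1)) \<partial>PiM I (\<lambda>_. lborel)) \<partial>lborel)"
    by (intro nn_integral_cong nn_integral_cmult) measurable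
  also have "\<dots> = (\<integral>\<^sup>+y. ennreal (pos_powr y (a j - 1)) * ennreal (C * pos_powr (s - y) (A + b - 1)) \<partial>lborel)"
    using insert by (simp add: A_def C_def)
  also have "\<dots> = (\<integral>\<^sup>+y. ennreal C * ennreal (pos_powr y (a j - 1) * pos_powr (s - y) (A + b - 1)) \<partial>lborel)"
    using C0 by (simp add: ennreal_mult' mult_ac)
  also have "\<dots> = ennreal C * ennreal (Beta (a j) (A + b) * pos_powr s (a j + (A + b) - 1))"
    using aj A by (subst nn_integral_cmult) (auto simp: nn_integral_beta_convolution)
  also have "\<dots> = ennreal (C * Beta (a j) (A + b) * pos_powr s (a j + (A + b) - 1))"
    using C0 by (simp add: ennreal_mult' mult_ac)
  also have "C * Beta (a j) (A + b) = Gamma (a j) * (\<Prod>i\<in>I. Gamma (a i)) * Gamma b / Gamma (a j + A + b)"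
    using Gamma_real_pos[OF A] by (simp add: C_def Beta_def add_ac)
  finally show ?case using insert by (simp add: A_def algebra_simps)
qed

lemma vec_borel_measurableI:
  fixes f :: "'a \<Rightarrow> real ^ 'n"
  assumes "\<And>i. (\<lambda>x. f x $ i) \<in> borel_measurable M"
  shows "f \<in> borel_measurable M"
  unfolding borel_measurable_euclidean_space[of f]
  using assms by (auto simp: Basis_vec_def inner_axis)

lemma vec_nth_borel_measurable [measurable]:
  fixes f :: "'a \<Rightarrow> real ^ 'n"
  assumes [measurable]: "f \<in> borel_measurable M"
  shows "(\<lambda>x. f x $ i) \<in> borel_measurable M"
  by (rule borel_measurable_continuous_on[OF continuous_on_component[OF continuous_on_id] assms])

lemma open_simplex_borel [measurable]: "open_simplex \<in> sets borel"
  unfolding open_simplex_def by measurable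

lemma simplex_point_measurable [measurable]:
  "simplex_point \<in> measurable (PiM {i::'k::{finite,linorder}. i \<noteq> Max UNIV} (\<lambda>_. lborel)) borel"
proof (rule vec_borel_measurableI)
  fix i :: 'k
  show "(\<lambda>x. simplex_point x $ i) \<in> borel_measurable (PiM {i. i \<noteq> Max UNIV} (\<lambda>_. lborel))"
    by (cases "i = Max UNIV") (auto simp: simplex_point_def)
qed

lemma dirichlet_density_measurable [measurable]: "dirichlet_density \<alpha> \<in> borel_measurable borel"
  unfolding dirichlet_density_def by measurable

lemma pos_coords_eq_pos_powr:
  "(if \<forall>i. 0 < x $ i then \<Prod>i\<in>UNIV. x $ i powr p i else 0) = (\<Prod>i\<in>UNIV. pos_powr (x $ i) (p i))"
  by (auto simp: pos_powr_def intro!: prod.cong prod_zero[symmetric])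

text \<open>
  With at least two coordinates the upper bounds \<open>x\<^sub>i < 1\<close> follow from positivity and the sum. With a
  single coordinate the open simplex would be empty.
\<close>

lemma mem_open_simplex_iff:
  fixes x :: "real ^ 'k"
  assumes "CARD('k) \<ge> 2"
  shows "x \<in> open_simplex \<longleftrightarrow> (\<forall>i. 0 < x $ i) \<and> (\<Sum>i\<in>UNIV. x $ i) = 1"
proof -
  have "x $ i < 1" if "\<forall>i. 0 < x $ i" "(\<Sum>i\<in>UNIV. x $ i) = 1" for i
  proof -
    have "card (UNIV - {i}) > 0" using assms by (simp add: card_Diff_singleton)
    then have "UNIV - {i} \<noteq> {}" by (metis card.empty less_irrefl)
    then have "(\<Sum>j\<in>UNIV - {i}. x $ j) > 0" using that by (intro sum_pos) auto
    moreover have "(\<Sum>i\<in>UNIV. x $ i) = x $ i + (\<Sum>j\<in>UNIV - {i}. x $ j)"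
      by (simp add: sum.remove)
    ultimately show ?thesis using that by simp
  qed
  then show ?thesis by (auto simp: open_simplex_def)
qed

lemma UNIV_insert_Max: "(UNIV :: 'k::{finite,linorder} set) = insert (Max UNIV) {i. i \<noteq> Max UNIV}"
  by auto

lemma sum_simplex_point: "(\<Sum>i\<in>UNIV. simplex_point x $ i) = 1"
  by (subst UNIV_insert_Max, subst sum.insert) (auto simp: simplex_point_def)

text \<open>
  The last coordinate of \<^const>\<open>simplex_point\<close> is the slack \<open>1 - \<Sum>x\<^sub>i\<close>, so the kernel above with
  \<open>s = 1\<close>, and with the exponent of the last coordinate as \<open>b\<close>, is the normalising constant.
\<close>

lemma nn_integral_simplex:
  fixes a :: "'k::{finite,linorder} \<Rightarrow> real"
  assumes k: "CARD('k) \<ge> 2" and a: "\<And>i. 0 < a i"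
  shows "(\<integral>\<^sup>+x. ennreal (if simplex_point x \<in> open_simplex then \<Prod>i\<in>UNIV. simplex_point x $ i powr (a i - 1) else 0)
            \<partial>PiM {i. i \<noteq> Max UNIV} (\<lambda>_. lborel))
         = ennreal ((\<Prod>i\<in>UNIV. Gamma (a i)) / Gamma (\<Sum>i\<in>UNIV. a i))" (is "?L = _")
proof -
  let ?m = "Max (UNIV :: 'k set)" and ?I = "{i :: 'k. i \<noteq> Max UNIV}"
  have "?L = (\<integral>\<^sup>+x. ennreal ((\<Prod>i\<in>?I. pos_powr (x i) (a i - 1)) * pos_powr (1 - (\<Sum>i\<in>?I. x i)) (a ?m - 1))
            \<partial>PiM ?I (\<lambda>_. lborel))"
  proof (rule nn_integral_cong, goal_cases)
    case (1 x)
    have "(if simplex_point x \<in> open_simplex then \<Prod>i\<in>UNIV. simplex_point x $ i powr (a i - 1) else 0)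
       = (\<Prod>i\<in>insert ?m ?I. pos_powr (simplex_point x $ i) (a i - 1))"
      unfolding mem_open_simplex_iff[OF k] pos_coords_eq_pos_powr[symmetric] UNIV_insert_Max[symmetric]
      by (simp add: sum_simplex_point)
    also have "\<dots> = (\<Prod>i\<in>?I. pos_powr (x i) (a i - 1)) * pos_powr (1 - (\<Sum>i\<in>?I. x i)) (a ?m - 1)"
      by (subst prod.insert) (auto simp: simplex_point_def mult_ac intro!: prod.cong)
    finally show ?case by simp
  qed
  also have "\<dots> = ennreal ((\<Prod>i\<in>?I. Gamma (a i)) * Gamma (a ?m) / Gamma ((\<Sum>i\<in>?I. a i) + a ?m)
              * pos_powr 1 ((\<Sum>i\<in>?I. a i) + a ?m - 1))"
    by (rule nn_integral_dirichlet_kernel) (auto simp: a)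
  also have "(\<Prod>i\<in>?I. Gamma (a i)) * Gamma (a ?m) = (\<Prod>i\<in>UNIV. Gamma (a i))"
    by (subst (2) UNIV_insert_Max, subst prod.insert) (auto simp: mult_ac)
  also have "(\<Sum>i\<in>?I. a i) + a ?m = (\<Sum>i\<in>UNIV. a i)"
    by (subst (2) UNIV_insert_Max, subst sum.insert) (auto simp: add_ac)
  finally show ?thesis by (simp add: pos_powr_def)
qed

section \<open>Moments of the Dirichlet distribution\<close>

lemma sets_dirichlet [simp, measurable_cong]: "sets (dirichlet \<alpha>) = sets borel"
  by (simp add: dirichlet_def)

lemma space_dirichlet [simp]: "space (dirichlet \<alpha>) = UNIV"
  by (simp add: dirichlet_def)

text \<open>
  Multiplying the density by \<open>x\<^sub>l ^ m\<close> gives an unnormalised Dirichlet density with \<open>\<alpha>\<^sub>l\<close> replaced by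
  \<open>\<alpha>\<^sub>l + m\<close>, so the moment is the quotient of the two normalising constants. The case \<open>m = 0\<close> says that
  the total mass is \<open>1\<close>.
\<close>

lemma nn_integral_dirichlet_power:
  fixes \<alpha> :: "real ^ 'k::{finite,linorder}"
  assumes k: "CARD('k) \<ge> 2" and \<alpha>: "\<alpha> \<in> dirichlet_params"
  shows "(\<integral>\<^sup>+x. ennreal (x $ l ^ m) \<partial>dirichlet \<alpha>)
       = ennreal (Gamma (\<alpha> $ l + m) / Gamma (\<alpha> $ l) * Gamma (\<Sum>i\<in>UNIV. \<alpha> $ i) / Gamma ((\<Sum>i\<in>UNIV. \<alpha> $ i) + m))"
proof -
  have pos: "0 < \<alpha> $ i" for i using \<alpha> by (auto simp: dirichlet_params_def)
  define A where "A = (\<Sum>i\<in>UNIV. \<alpha> $ i)"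
  define a where "a i = \<alpha> $ i + (if i = l then real m else 0)" for i
  have A0: "A > 0" unfolding A_def by (intro sum_pos) (auto simp: pos)
  define c where "c = Gamma A / (\<Prod>i\<in>UNIV. Gamma (\<alpha> $ i))"
  have c0: "c \<ge> 0" unfolding c_def
    by (intro divide_nonneg_nonneg prod_nonneg) (auto simp: less_imp_le Gamma_real_pos A0 pos)
  have "(\<integral>\<^sup>+x. ennreal (x $ l ^ m) \<partial>dirichlet \<alpha>)
     = (\<integral>\<^sup>+x. ennreal (dirichlet_density \<alpha> (simplex_point x)) * ennreal (simplex_point x $ l ^ m) \<partial>PiM {i. i \<noteq> Max UNIV} (\<lambda>_. lborel))"
    unfolding dirichlet_def by (subst nn_integral_distr) (simp_all add: nn_integral_density)
  also have "\<dots> = (\<integral>\<^sup>+x. ennreal c * ennreal (if simplex_point x \<in> open_simplex then \<Prod>i\<in>UNIV. simplex_point x $ i powr (a i - 1) else 0)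
            \<partial>PiM {i. i \<noteq> Max UNIV} (\<lambda>_. lborel))"
  proof (rule nn_integral_cong, goal_cases)
    case (1 x)
    let ?y = "simplex_point x"
    show ?case
    proof (cases "?y \<in> open_simplex")
      case True
      then have y: "0 < ?y $ i" for i by (auto simp: open_simplex_def)
      have "(\<Prod>i\<in>UNIV. ?y $ i powr (a i - 1)) = (\<Prod>i\<in>UNIV. ?y $ i powr (\<alpha> $ i - 1) * (if i = l then ?y $ i ^ m else 1))"
        using y by (intro prod.cong) (auto simp: a_def powr_add[symmetric] powr_realpow[symmetric] less_imp_neq[THEN not_sym] algebra_simps)
      also have "\<dots> = (\<Prod>i\<in>UNIV. ?y $ i powr (\<alpha> $ i - 1)) * ?y $ l ^ m"
        by (simp add: prod.distrib)
      finally show ?thesis using True c0 y[of l]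
        by (simp add: dirichlet_density_def c_def A_def ennreal_mult'[symmetric] ennreal_mult''[symmetric] mult_ac)
    qed (simp add: dirichlet_density_def)
  qed
  also have "\<dots> = ennreal c * ennreal ((\<Prod>i\<in>UNIV. Gamma (a i)) / Gamma (\<Sum>i\<in>UNIV. a i))"
    by (subst nn_integral_cmult, measurable, subst nn_integral_simplex[OF k]) (auto simp: a_def pos add_pos_nonneg)
  also have "\<dots> = ennreal (c * ((\<Prod>i\<in>UNIV. Gamma (a i)) / Gamma (\<Sum>i\<in>UNIV. a i)))"
    by (rule ennreal_mult'[symmetric, OF c0])
  also have "(\<Sum>i\<in>UNIV. a i) = A + m" by (simp add: a_def A_def sum.distrib)
  also have "(\<Prod>i\<in>UNIV. Gamma (a i)) = (\<Prod>i\<in>UNIV. Gamma (\<alpha> $ i) * (if i = l then Gamma (\<alpha> $ i + m) / Gamma (\<alpha> $ i) else 1))"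
  proof (rule prod.cong)
    fix i show "Gamma (a i) = Gamma (\<alpha> $ i) * (if i = l then Gamma (\<alpha> $ i + m) / Gamma (\<alpha> $ i) else 1)"
      using Gamma_real_pos[OF pos[of i]] by (cases "i = l") (simp_all add: a_def)
  qed simp
  also have "\<dots> = (\<Prod>i\<in>UNIV. Gamma (\<alpha> $ i)) * (Gamma (\<alpha> $ l + m) / Gamma (\<alpha> $ l))"
    by (simp add: prod.distrib)
  also have "c * ((\<Prod>i\<in>UNIV. Gamma (\<alpha> $ i)) * (Gamma (\<alpha> $ l + m) / Gamma (\<alpha> $ l)) / Gamma (A + m))
     = Gamma (\<alpha> $ l + m) / Gamma (\<alpha> $ l) * Gamma A / Gamma (A + m)"
  proof -
    have "(\<Prod>i\<in>UNIV. Gamma (\<alpha> $ i)) \<noteq> 0" using pos Gamma_real_pos by (metis finite prod_zero_iff less_irrefl)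
    then show ?thesis by (simp add: c_def)
  qed
  finally show ?thesis by (simp add: A_def)
qed

context
  fixes \<alpha> :: "real ^ 'k::{finite,linorder}" and A :: real
  assumes k: "CARD('k) \<ge> 2" and \<alpha>: "\<alpha> \<in> dirichlet_params"
  defines "A \<equiv> (\<Sum>i\<in>UNIV. \<alpha> $ i)"
begin

lemma dirichlet_params_bounds: "0 < \<alpha> $ i" "\<alpha> $ i < A"
proof -
  show pos: "0 < \<alpha> $ i" for i using \<alpha> by (auto simp: dirichlet_params_def)
  have "card (UNIV - {i}) > 0" using k by (simp add: card_Diff_singleton)
  then have "UNIV - {i} \<noteq> {}" by (metis card.empty less_irrefl)
  then have "(\<Sum>j\<in>UNIV - {i}. \<alpha> $ j) > 0" by (intro sum_pos) (auto simp: pos)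
  moreover have "A = \<alpha> $ i + (\<Sum>j\<in>UNIV - {i}. \<alpha> $ j)"
    by (simp add: sum.remove A_def)
  ultimately show "\<alpha> $ i < A" by simp
qed

lemma dirichlet_params_sum_pos: "0 < A"
  using dirichlet_params_bounds by (rule less_trans)

lemma prob_space_dirichlet: "prob_space (dirichlet \<alpha>)"
proof
  have "emeasure (dirichlet \<alpha>) (space (dirichlet \<alpha>)) = (\<integral>\<^sup>+x. ennreal (x $ undefined ^ 0) \<partial>dirichlet \<alpha>)"
    by simp
  also have "\<dots> = 1"
    using Gamma_real_pos[OF dirichlet_params_bounds(1)[of undefined]] Gamma_real_pos[OF dirichlet_params_sum_pos]
    by (subst nn_integral_dirichlet_power[OF k \<alpha>]) (simp add: A_def)
  finally show "emeasure (dirichlet \<alpha>) (space (dirichlet \<alpha>)) = 1" .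
qed

lemma AE_dirichlet_open_simplex: "AE x in dirichlet \<alpha>. x \<in> open_simplex"
proof -
  have "AE x in PiM {i. i \<noteq> Max UNIV} (\<lambda>_. lborel). 0 < ennreal (dirichlet_density \<alpha> (simplex_point x)) \<longrightarrow> simplex_point x \<in> open_simplex"
    by (auto simp: dirichlet_density_def)
  then show ?thesis
    unfolding dirichlet_def by (subst AE_distr_iff) (auto simp: AE_density)
qed

lemma integral_dirichlet_power:
  shows "integrable (dirichlet \<alpha>) (\<lambda>x. x $ l ^ m)"
    and "(\<integral>x. x $ l ^ m \<partial>dirichlet \<alpha>) = Gamma (\<alpha> $ l + m) / Gamma (\<alpha> $ l) * Gamma A / Gamma (A + m)"
proof -
  have nn: "AE x in dirichlet \<alpha>. 0 \<le> x $ l ^ m"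
    using AE_dirichlet_open_simplex by eventually_elim (auto simp: open_simplex_def less_imp_le)
  have 1: "0 < \<alpha> $ l + m" "0 < A + m" using dirichlet_params_bounds[of l] dirichlet_params_sum_pos by auto
  have "0 \<le> Gamma (\<alpha> $ l + m) / Gamma (\<alpha> $ l) * Gamma A / Gamma (A + m)"
    using Gamma_real_pos[OF 1(1)] Gamma_real_pos[OF 1(2)] Gamma_real_pos[OF dirichlet_params_bounds(1)[of l]]
      Gamma_real_pos[OF dirichlet_params_sum_pos] by simp
  then have "has_bochner_integral (dirichlet \<alpha>) (\<lambda>x. x $ l ^ m) (Gamma (\<alpha> $ l + m) / Gamma (\<alpha> $ l) * Gamma A / Gamma (A + m))"
    using nn nn_integral_dirichlet_power[OF k \<alpha>, of l m]
    by (intro has_bochner_integral_nn_integral) (auto simp: A_def)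
  then show "integrable (dirichlet \<alpha>) (\<lambda>x. x $ l ^ m)"
    "(\<integral>x. x $ l ^ m \<partial>dirichlet \<alpha>) = Gamma (\<alpha> $ l + m) / Gamma (\<alpha> $ l) * Gamma A / Gamma (A + m)"
    by (auto simp: has_bochner_integral_iff)
qed

lemma dirichlet_mean: "(\<integral>x. x $ i \<partial>dirichlet \<alpha>) = \<alpha> $ i / A"
  and dirichlet_second_moment: "(\<integral>x. (x $ i)\<^sup>2 \<partial>dirichlet \<alpha>) = \<alpha> $ i * (\<alpha> $ i + 1) / (A * (A + 1))"
proof -
  have G1: "Gamma (x + 1) = x * Gamma x" if "x > 0" for x :: real
    using that by (intro Gamma_plus1) (auto dest: nonpos_Ints_nonpos)
  have G2: "Gamma (x + 2) = (x + 1) * x * Gamma x" if "x > 0" for x :: real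
    using that G1[of x] G1[of "x + 1"] by (simp add: add.assoc)
  note p = dirichlet_params_bounds[of i] dirichlet_params_sum_pos and g = Gamma_real_pos[OF dirichlet_params_bounds(1)[of i]]
      Gamma_real_pos[OF dirichlet_params_sum_pos]
  show "(\<integral>x. x $ i \<partial>dirichlet \<alpha>) = \<alpha> $ i / A"
    using integral_dirichlet_power(2)[of i 1] p g by (simp add: G1)
  show "(\<integral>x. (x $ i)\<^sup>2 \<partial>dirichlet \<alpha>) = \<alpha> $ i * (\<alpha> $ i + 1) / (A * (A + 1))"
    using integral_dirichlet_power(2)[of i 2] p g by (simp add: G2 mult_ac)
qed

end

section \<open>Convergence in law from trigonometric integrals\<close>

text \<open>
  Finite sums of real waves. The phase \<open>b\<close> covers sines as well, which keeps a single kind of generator.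
\<close>

inductive_set trig_sums :: "('a::euclidean_space \<Rightarrow> real) set" where
  cosine: "(\<lambda>x. c * cos (t \<bullet> x + b)) \<in> trig_sums"
| add: "f \<in> trig_sums \<Longrightarrow> g \<in> trig_sums \<Longrightarrow> (\<lambda>x. f x + g x) \<in> trig_sums"

lemma trig_sums_const: "(\<lambda>_. c) \<in> trig_sums"
  using trig_sums.cosine[of c 0 0] by simp

text \<open>
  By the product-to-sum identity the sums of waves form an algebra, as Stone--Weierstrass requires.
\<close>

lemma trig_sums_cosine_mult: "f \<in> trig_sums \<Longrightarrow> (\<lambda>x. c * cos (t \<bullet> x + b) * f x) \<in> trig_sums"
proof (induction rule: trig_sums.induct)
  case (cosine c' t' b')
  have eq: "c * cos (t \<bullet> x + b) * (c' * cos (t' \<bullet> x + b'))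
     = c * c' / 2 * cos ((t - t') \<bullet> x + (b - b')) + c * c' / 2 * cos ((t + t') \<bullet> x + (b + b'))" for x
  proof -
    have *: "(t - t') \<bullet> x + (b - b') = (t \<bullet> x + b) - (t' \<bullet> x + b')"
      "(t + t') \<bullet> x + (b + b') = (t \<bullet> x + b) + (t' \<bullet> x + b')"
      by (simp_all add: inner_add_left inner_diff_left)
    have "c * cos u * (c' * cos v) = c * c' / 2 * cos (u - v) + c * c' / 2 * cos (u + v)" for u v :: real
      by (simp add: cos_add cos_diff field_simps)
    then show ?thesis unfolding * .
  qed
  show ?case unfolding eq by (intro trig_sums.intros)
next
  case (add f g)
  then show ?case using trig_sums.add by (fastforce simp: distrib_left)
qed

lemma trig_sums_mult: "f \<in> trig_sums \<Longrightarrow> g \<in> trig_sums \<Longrightarrow> (\<lambda>x. f x * g x) \<in> trig_sums"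
proof (induction rule: trig_sums.induct)
  case (cosine c t b)
  then show ?case by (rule trig_sums_cosine_mult)
next
  case (add f f')
  then show ?case using trig_sums.add by (fastforce simp: distrib_right)
qed

lemma trig_sums_continuous: "f \<in> trig_sums \<Longrightarrow> continuous_on UNIV f"
  by (induction rule: trig_sums.induct) (auto intro!: continuous_intros)

lemma trig_sums_bounded: "f \<in> trig_sums \<Longrightarrow> \<exists>B. \<forall>x. \<bar>f x\<bar> \<le> B"
proof (induction rule: trig_sums.induct)
  case (cosine c t b)
  have "\<bar>c * cos (t \<bullet> x + b)\<bar> \<le> \<bar>c\<bar>" for x
    by (simp add: abs_mult mult_left_le)
  then show ?case by blast
next
  case (add f g)
  then obtain B C where "\<forall>x. \<bar>f x\<bar> \<le> B" "\<forall>x. \<bar>g x\<bar> \<le> C" by blast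
  then have "\<forall>x. \<bar>f x + g x\<bar> \<le> B + C"
    by (meson abs_triangle_ineq add_mono order_trans)
  then show ?case by blast
qed

lemma trig_sums_polynomial:
  assumes "real_polynomial_function q" and f: "f \<in> trig_sums"
  shows "(\<lambda>x. q (f x)) \<in> trig_sums"
  using assms(1)
proof (induction q rule: real_polynomial_function.induct)
  case (linear q)
  then interpret bounded_linear q .
  have "q y = q 1 * y" for y using scaleR[of y 1] by simp
  then have "(\<lambda>x. q (f x)) = (\<lambda>x. q 1 * f x)" by blast
  then show ?case using trig_sums_mult[OF trig_sums_const f] by simp
qed (auto intro: trig_sums_const trig_sums.add trig_sums_mult)

text \<open>
  Choose the frequency along \<open>x - y\<close> and the phase so that the wave is at its maximum in \<open>y\<close> and at its
  minimum in \<open>x\<close>.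
\<close>

lemma trig_sums_separate:
  fixes x y :: "'a::euclidean_space"
  assumes "x \<noteq> y"
  shows "\<exists>f\<in>trig_sums. f x \<noteq> f y"
proof -
  define t where "t = (pi / (norm (x - y))\<^sup>2) *\<^sub>R (x - y)"
  have "t \<bullet> x + - (t \<bullet> y) = t \<bullet> (x - y)" by (simp add: inner_diff_right)
  also have "\<dots> = pi" using assms by (simp add: t_def dot_square_norm)
  finally have "t \<bullet> x + - (t \<bullet> y) = pi" .
  then have "cos (t \<bullet> x + - (t \<bullet> y)) \<noteq> cos (t \<bullet> y + - (t \<bullet> y))" by simp
  then show ?thesis by (intro bexI[OF _ trig_sums.cosine[of 1 t "- (t \<bullet> y)"]]) simp
qed

text \<open>
  Stone--Weierstrass alone gives an approximation \<open>p\<close> on \<open>K\<close> that may be large elsewhere. Since \<open>p\<close>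
  is globally bounded by some \<open>C\<close>, truncation to \<open>[-B, B]\<close> can be replaced, uniformly on \<open>[-C, C]\<close>, by
  a polynomial \<open>q\<close>. Then \<open>q \<circ> p\<close> is again a sum of waves; truncation does not increase the distance to
  \<open>f\<close>, so it is still close to \<open>f\<close> on \<open>K\<close>, and it is almost bounded by \<open>B\<close> everywhere.
\<close>

lemma trig_sums_approx:
  fixes f :: "'a::euclidean_space \<Rightarrow> real"
  assumes f: "continuous_on UNIV f" "\<And>x. \<bar>f x\<bar> \<le> B" and K: "compact K" and e: "0 < e"
  obtains p where "p \<in> trig_sums" "\<And>x. x \<in> K \<Longrightarrow> \<bar>f x - p x\<bar> < e" "\<And>x. \<bar>p x\<bar> \<le> B + e"
proof -
  interpret function_ring_on trig_sums K
    by unfold_locales (use K trig_sums_separate in \<open>auto intro: trig_sums.add trig_sums_mult trig_sums_const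
      continuous_on_subset[OF trig_sums_continuous]\<close>)
  obtain p where p: "p \<in> trig_sums" "\<And>x. x \<in> K \<Longrightarrow> \<bar>f x - p x\<bar> < e / 2"
    using Stone_Weierstrass_basic[of f "e / 2"] continuous_on_subset[OF f(1)] e by auto
  obtain C where C: "\<And>x. \<bar>p x\<bar> \<le> C" using trig_sums_bounded[OF p(1)] by blast
  define clip where "clip y = max (- B) (min B y)" for y
  have "continuous_on {- C..C} clip" unfolding clip_def by (intro continuous_intros)
  then obtain q where q: "real_polynomial_function q" "\<And>y. y \<in> {- C..C} \<Longrightarrow> \<bar>clip y - q y\<bar> < e / 2"
    using Stone_Weierstrass_real_polynomial_function[of "{- C..C}" clip "e / 2"] e by auto
  have qp: "\<bar>clip (p x) - q (p x)\<bar> < e / 2" for x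
    using q(2)[of "p x"] C[of x] by (simp add: abs_le_iff)
  show thesis
  proof (rule that[of "\<lambda>x. q (p x)"])
    show "(\<lambda>x. q (p x)) \<in> trig_sums" by (rule trig_sums_polynomial[OF q(1) p(1)])
    show "\<bar>f x - q (p x)\<bar> < e" if "x \<in> K" for x
    proof -
      have "\<bar>f x - clip (p x)\<bar> \<le> \<bar>f x - p x\<bar>"
        unfolding clip_def using f(2)[of x] by linarith
      then show ?thesis using qp[of x] p(2)[OF that] by linarith
    qed
    show "\<bar>q (p x)\<bar> \<le> B + e" for x
    proof -
      have "\<bar>clip (p x)\<bar> \<le> B" unfolding clip_def using f(2)[of x] by linarith
      then show ?thesis using qp[of x] e by linarith
    qed
  qed
qed

lemma integral_diff_le_on_ball:
  fixes f g :: "'b::euclidean_space \<Rightarrow> real"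
  assumes "prob_space P" and sP: "sets P = sets borel"
    and cont: "continuous_on UNIV f" "continuous_on UNIV g"
    and bounds: "\<And>x. \<bar>f x\<bar> \<le> B" "\<And>x. \<bar>g x\<bar> \<le> C"
    and close: "\<And>x. norm x \<le> R \<Longrightarrow> \<bar>f x - g x\<bar> \<le> e" and D: "\<And>x. \<bar>f x - g x\<bar> \<le> D" and e: "0 \<le> e"
  shows "\<bar>(\<integral>x. f x \<partial>P) - (\<integral>x. g x \<partial>P)\<bar> \<le> e + D * measure P {x. R < norm x}"
proof -
  interpret prob_space P by fact
  note [measurable_cong] = sP
  have [measurable]: "f \<in> borel_measurable borel" "g \<in> borel_measurable borel"
    by (rule borel_measurable_continuous_onI[OF cont(1)], rule borel_measurable_continuous_onI[OF cont(2)])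
  have sp: "space P = UNIV" using sets_eq_imp_space_eq[OF sP] by simp
  have [measurable]: "{x. R < norm x} \<in> sets P" unfolding sP by measurable
  have int: "integrable P f" "integrable P g"
    by (rule integrable_const_bound[of _ B]; use bounds(1) in simp)
      (rule integrable_const_bound[of _ C]; use bounds(2) in simp)
  have i2: "integrable P (indicator {x. R < norm x} :: _ \<Rightarrow> real)"
    by (rule integrable_const_bound[of _ 1]) auto
  have "\<bar>(\<integral>x. f x \<partial>P) - (\<integral>x. g x \<partial>P)\<bar> = \<bar>\<integral>x. f x - g x \<partial>P\<bar>"
    using int by simp
  also have "\<dots> \<le> (\<integral>x. \<bar>f x - g x\<bar> \<partial>P)" by (rule integral_abs_bound)
  also have "\<dots> \<le> (\<integral>x. e + D * indicator {x. R < norm x} x \<partial>P)"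
  proof (rule integral_mono)
    show "integrable P (\<lambda>x. \<bar>f x - g x\<bar>)" using int by auto
    show "integrable P (\<lambda>x. e + D * indicator {x. R < norm x} x)" using i2 by auto
    show "\<bar>f x - g x\<bar> \<le> e + D * indicator {x. R < norm x} x" for x
      using close[of x] D[of x] e by (cases "R < norm x") auto
  qed
  also have "\<dots> = e + D * measure P {x. R < norm x}"
    using i2 prob_space by (simp add: sp)
  finally show ?thesis .
qed

lemma trig_sums_integral_tendsto:
  fixes \<mu> :: "nat \<Rightarrow> 'b::euclidean_space measure"
  assumes prob: "\<And>n. prob_space (\<mu> n)" "prob_space \<nu>"
    and sets: "\<And>n. sets (\<mu> n) = sets borel" "sets \<nu> = sets borel"
    and cos: "\<And>t b. (\<lambda>n. \<integral>x. cos (t \<bullet> x + b) \<partial>\<mu> n) \<longlonglongrightarrow> (\<integral>x. cos (t \<bullet> x + b) \<partial>\<nu>)"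
    and "p \<in> trig_sums"
  shows "(\<lambda>n. \<integral>x. p x \<partial>\<mu> n) \<longlonglongrightarrow> (\<integral>x. p x \<partial>\<nu>)"
  using assms(6)
proof (induction rule: trig_sums.induct)
  case (cosine c t b)
  show ?case using tendsto_mult_left[OF cos[of t b], of c] by simp
next
  case (add f g)
  have int: "integrable P h" if P: "prob_space P" "sets P = sets borel" and h: "h \<in> trig_sums"
    for h and P :: "'b measure"
  proof -
    interpret prob_space P by fact
    obtain B where "\<forall>x. \<bar>h x\<bar> \<le> B" using trig_sums_bounded[OF h] by blast
    then show ?thesis
      using borel_measurable_continuous_onI[OF trig_sums_continuous[OF h]] measurable_cong_sets[OF P(2)]
      by (intro integrable_const_bound[of _ B]) auto
  qed
  show ?case
    using tendsto_add[OF add.IH] by (simp add: Bochner_Integration.integral_add int prob sets add.hyps)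
qed

lemma prob_norm_tail:
  fixes P :: "'b::euclidean_space measure"
  assumes "prob_space P" and sP: "sets P = sets borel" and e: "0 < e"
  shows "\<exists>R. measure P {x. R < norm x} \<le> e"
proof -
  interpret prob_space P by fact
  have "(\<lambda>n. measure P {x. real n < norm x}) \<longlonglongrightarrow> measure P (\<Inter>n. {x. real n < norm x})"
    by (rule finite_Lim_measure_decseq) (auto simp: sP decseq_def)
  also have "(\<Inter>n. {x :: 'b. real n < norm x}) = {}"
  proof -
    have "\<exists>n. \<not> real n < norm x" for x :: 'b
      by (meson reals_Archimedean2 less_asym)
    then show ?thesis by auto
  qed
  finally have "(\<lambda>n. measure P {x. real n < norm x}) \<longlonglongrightarrow> 0" by simp
  then have "\<forall>\<^sub>F n in sequentially. measure P {x. real n < norm x} < e"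
    using e by (rule order_tendstoD)
  then obtain n where "measure P {x. real n < norm x} < e"
    using eventually_happens'[OF sequentially_bot] by blast
  then show ?thesis by (blast intro: less_imp_le)
qed

text \<open>
  A form of the multivariate continuity theorem, with tightness assumed. Outside a large ball all measures concerned
  have small mass (by tightness for the sequence, automatically for the limit); inside, \<open>f\<close> may be
  replaced by a sum of waves, for which convergence holds by linearity.
\<close>

theorem converges_in_law_if_cos:
  fixes \<mu> :: "nat \<Rightarrow> 'b::euclidean_space measure"
  assumes prob: "\<And>n. prob_space (\<mu> n)" "prob_space \<nu>"
    and sets: "\<And>n. sets (\<mu> n) = sets borel" "sets \<nu> = sets borel"
    and cos: "\<And>t b. (\<lambda>n. \<integral>x. cos (t \<bullet> x + b) \<partial>\<mu> n) \<longlonglongrightarrow> (\<integral>x. cos (t \<bullet> x + b) \<partial>\<nu>)"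
    and tight: "\<And>e. 0 < e \<Longrightarrow> \<exists>R. \<forall>\<^sub>F n in sequentially. measure (\<mu> n) {x. R < norm x} \<le> e"
  shows "converges_in_law \<mu> \<nu>"
  unfolding converges_in_law_def
proof (intro allI impI)
  fix f :: "'b \<Rightarrow> real"
  assume cont: "continuous_on UNIV f" and "bounded (range f)"
  then obtain B where B: "\<And>x. \<bar>f x\<bar> \<le> B" by (auto simp: bounded_iff)
  have B0: "0 \<le> B" using B[of 0] by linarith
  show "(\<lambda>n. \<integral>x. f x \<partial>\<mu> n) \<longlonglongrightarrow> (\<integral>x. f x \<partial>\<nu>)"
  proof (rule tendstoI)
    fix r :: real assume r: "0 < r"
    define e where "e = min 1 (r / 8)"
    \<comment> \<open>The approximating sum is bounded by \<open>B + e \<le> B + 1\<close>, so on the tail the error is at most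
      \<open>2 * B + 1\<close>; the tail mass \<open>d\<close> is chosen to turn this into \<open>e\<close>.\<close>
    define d where "d = e / (2 * B + 1)"
    have e: "0 < e" "e \<le> 1" "8 * e \<le> r" using r by (auto simp: e_def)
    have d: "0 < d" "(2 * B + 1) * d = e" using e B0 by (auto simp: d_def)
    obtain R1 where R1: "\<forall>\<^sub>F n in sequentially. measure (\<mu> n) {x. R1 < norm x} \<le> d"
      using tight[OF d(1)] by blast
    obtain R2 where R2: "measure \<nu> {x. R2 < norm x} \<le> d"
      using prob_norm_tail[OF prob(2) sets(2) d(1)] by blast
    define R where "R = max R1 R2"
    have mono: "measure P {x. R < norm x} \<le> d"
      if "prob_space P" "sets P = sets borel" "measure P {x. S < norm x} \<le> d" "S \<le> R" for P :: "'b measure" and S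
    proof -
      interpret prob_space P by fact
      have "measure P {x. R < norm x} \<le> measure P {x. S < norm x}"
        by (rule finite_measure_mono) (use that in auto)
      with that show ?thesis by simp
    qed
    obtain p where p: "p \<in> trig_sums" "\<And>x. x \<in> cball 0 R \<Longrightarrow> \<bar>f x - p x\<bar> < e" "\<And>x. \<bar>p x\<bar> \<le> B + e"
      using trig_sums_approx[OF cont B compact_cball[of 0 R] e(1)] by blast
    have close: "\<bar>(\<integral>x. f x \<partial>P) - (\<integral>x. p x \<partial>P)\<bar> \<le> 2 * e"
      if P: "prob_space P" "sets P = sets borel" "measure P {x. S < norm x} \<le> d" "S \<le> R" for P :: "'b measure" and S
    proof -
      have "\<bar>(\<integral>x. f x \<partial>P) - (\<integral>x. p x \<partial>P)\<bar> \<le> e + (2 * B + 1) * measure P {x. R < norm x}"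
      proof (rule integral_diff_le_on_ball[OF P(1,2) cont trig_sums_continuous[OF p(1)] B p(3)])
        show "\<bar>f x - p x\<bar> \<le> e" if "norm x \<le> R" for x using p(2)[of x] that by simp
        show "\<bar>f x - p x\<bar> \<le> 2 * B + 1" for x using B[of x] p(3)[of x] e by linarith
      qed (use e in simp)
      also have "\<dots> \<le> e + (2 * B + 1) * d"
        using mono[OF P] B0 by (intro add_left_mono mult_left_mono) auto
      finally show ?thesis using d by simp
    qed
    have "\<forall>\<^sub>F n in sequentially. dist (\<integral>x. p x \<partial>\<mu> n) (\<integral>x. p x \<partial>\<nu>) < r / 2"
      using trig_sums_integral_tendsto[OF prob sets cos p(1)] r by (intro tendstoD) auto
    then show "\<forall>\<^sub>F n in sequentially. dist (\<integral>x. f x \<partial>\<mu> n) (\<integral>x. f x \<partial>\<nu>) < r"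
      using R1
    proof eventually_elim
      case (elim n)
      have "\<bar>(\<integral>x. f x \<partial>\<mu> n) - (\<integral>x. p x \<partial>\<mu> n)\<bar> \<le> 2 * e"
        by (rule close[OF prob(1) sets(1) elim(2)]) (simp add: R_def)
      moreover have "\<bar>(\<integral>x. f x \<partial>\<nu>) - (\<integral>x. p x \<partial>\<nu>)\<bar> \<le> 2 * e"
        by (rule close[OF prob(2) sets(2) R2]) (simp add: R_def)
      ultimately show ?case using elim(1) e unfolding dist_real_def by linarith
    qed
  qed
qed


section \<open>Existence of centered normal laws\<close>

text \<open>
  Completing the square. In the quadratic form on \<open>insert a I\<close> the variable \<open>t\<^sub>a\<close> is removed by
  subtracting \<open>(\<Sum> t\<^sub>i C\<^sub>a\<^sub>i)\<^sup>2 / C\<^sub>a\<^sub>a\<close>; the remaining form on \<open>I\<close> is the minimum of the original one over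
  \<open>t\<^sub>a\<close>, hence again nonnegative. If \<open>C\<^sub>a\<^sub>a = 0\<close>, nonnegativity forces the row of \<open>a\<close> to vanish, and
  division by zero yielding \<open>0\<close> makes the same formulas correct.
\<close>

lemma positive_semidefinite_factorization:
  fixes C :: "'i \<Rightarrow> 'i \<Rightarrow> real"
  assumes "finite I"
    and sym: "\<And>i j. C i j = C j i"
    and psd: "\<And>t. 0 \<le> (\<Sum>i\<in>I. \<Sum>j\<in>I. t i * t j * C i j)"
  shows "\<exists>l :: 'i \<Rightarrow> 'i \<Rightarrow> real. \<forall>i\<in>I. \<forall>j\<in>I. C i j = (\<Sum>m\<in>I. l m i * l m j)"
  using assms
proof (induction I arbitrary: C rule: finite_induct)
  case empty
  then show ?case by simp
next
  case (insert a I C)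
  note sym = insert.prems(1) and psd = insert.prems(2)
  have expand: "(\<Sum>i\<in>insert a I. \<Sum>j\<in>insert a I. t i * t j * C i j)
     = (t a)\<^sup>2 * C a a + 2 * t a * (\<Sum>i\<in>I. t i * C a i) + (\<Sum>i\<in>I. \<Sum>j\<in>I. t i * t j * C i j)" for t
  proof -
    have "(\<Sum>i\<in>I. t i * t a * C i a) = t a * (\<Sum>i\<in>I. t i * C a i)"
      "(\<Sum>i\<in>I. t a * t i * C a i) = t a * (\<Sum>i\<in>I. t i * C a i)"
      by (simp_all add: sum_distrib_left sym[of a] mult_ac)
    then show ?thesis using insert.hyps by (simp add: sum.distrib power2_eq_square algebra_simps)
  qed
  have upd: "(\<Sum>i\<in>I. (t(a := s)) i * C a i) = (\<Sum>i\<in>I. t i * C a i)"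
    "(\<Sum>i\<in>I. \<Sum>j\<in>I. (t(a := s)) i * (t(a := s)) j * C i j) = (\<Sum>i\<in>I. \<Sum>j\<in>I. t i * t j * C i j)" for t s
    using insert.hyps by (auto intro!: sum.cong)
  have quadratic: "0 \<le> s\<^sup>2 * C a a + 2 * s * (\<Sum>i\<in>I. t i * C a i) + (\<Sum>i\<in>I. \<Sum>j\<in>I. t i * t j * C i j)" for s t
    using psd[of "t(a := s)"] unfolding expand upd by simp
  have Caa: "0 \<le> C a a" using quadratic[of 1 "\<lambda>_. 0"] by simp
  have zero: "C a j = 0" if "C a a = 0" "j \<in> I" for j
  proof (rule ccontr)
    assume ne: "C a j \<noteq> 0"
    have "(\<Sum>i\<in>I. (if i = j then 1 else 0) * C a i) = C a j"
      using insert.hyps that(2) by (simp add: if_distrib[of "\<lambda>x. x * _"] cong: if_cong)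
    moreover have "(\<Sum>i\<in>I. \<Sum>k\<in>I. (if i = j then 1 else 0) * (if k = j then 1 else 0) * C i k) = C j j"
      unfolding mult.assoc sum_distrib_left[symmetric]
      using insert.hyps that(2) by (simp add: if_distrib[of "\<lambda>x. x * _"] cong: if_cong)
    ultimately have "0 \<le> 2 * s * C a j + C j j" for s
      using quadratic[of s "\<lambda>i. if i = j then 1 else 0"] that(1) by simp
    \<comment> \<open>An affine function of \<open>s\<close> with nonzero slope is negative somewhere.\<close>
    moreover have "2 * (- (C j j + 1) / (2 * C a j)) * C a j + C j j = - 1"
      using ne by (simp add: field_simps)
    ultimately show False by (metis neg_0_le_iff_le not_one_le_zero)
  qed
  define C' where "C' i j = C i j - C a i * C a j / C a a" for i j
  have "\<exists>l :: 'i \<Rightarrow> 'i \<Rightarrow> real. \<forall>i\<in>I. \<forall>j\<in>I. C' i j = (\<Sum>m\<in>I. l m i * l m j)"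
  proof (rule insert.IH)
    show "C' i j = C' j i" for i j by (simp add: C'_def sym[of i j])
    fix t :: "'i \<Rightarrow> real"
    define S where "S = (\<Sum>i\<in>I. t i * C a i)"
    have "S * S = (\<Sum>i\<in>I. \<Sum>j\<in>I. t i * t j * (C a i * C a j))"
      unfolding S_def sum_product by (simp add: mult_ac)
    then have "(\<Sum>i\<in>I. \<Sum>j\<in>I. t i * t j * C' i j) = (\<Sum>i\<in>I. \<Sum>j\<in>I. t i * t j * C i j) - S * S / C a a"
      by (simp add: C'_def right_diff_distrib sum_subtractf sum_divide_distrib)
    also have "\<dots> = (- S / C a a)\<^sup>2 * C a a + 2 * (- S / C a a) * S + (\<Sum>i\<in>I. \<Sum>j\<in>I. t i * t j * C i j)"
      by (cases "C a a = 0") (simp_all add: power2_eq_square)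
    also have "\<dots> \<ge> 0" unfolding S_def by (rule quadratic)
    finally show "0 \<le> (\<Sum>i\<in>I. \<Sum>j\<in>I. t i * t j * C' i j)" .
  qed
  then obtain l where l: "\<And>i j. i \<in> I \<Longrightarrow> j \<in> I \<Longrightarrow> C' i j = (\<Sum>m\<in>I. l m i * l m j)" by blast
  define l' where "l' m i = (if m = a then C a i / sqrt (C a a) else if i = a then 0 else l m i)" for m i
  have sq: "C a i / sqrt (C a a) * (C a j / sqrt (C a a)) = C a i * C a j / C a a" for i j
    using Caa by simp
  have l'_I: "(\<Sum>m\<in>I. l' m i * l' m j) = (if i = a \<or> j = a then 0 else \<Sum>m\<in>I. l m i * l m j)" for i j
    using insert.hyps by (auto simp: l'_def intro!: sum.cong sum.neutral)
  have "C i j = (\<Sum>m\<in>insert a I. l' m i * l' m j)" if ij: "i \<in> insert a I" "j \<in> insert a I" for i j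
  proof -
    have "(\<Sum>m\<in>insert a I. l' m i * l' m j)
        = C a i * C a j / C a a + (if i = a \<or> j = a then 0 else \<Sum>m\<in>I. l m i * l m j)"
    proof -
      have "l' a i * l' a j = C a i * C a j / C a a"
        unfolding l'_def using sq by simp
      then show ?thesis using insert.hyps l'_I[of i j] by simp
    qed
    also have "\<dots> = C i j"
    proof (cases "i = a \<or> j = a")
      case True
      have zero': "C a x = 0" if "C a a = 0" "x \<in> insert a I" for x using zero that by auto
      from True show ?thesis
      proof
        assume "i = a"
        then show ?thesis using zero'[OF _ ij(2)] by (cases "C a a = 0") simp_all
      next
        assume "j = a"
        then show ?thesis using zero'[OF _ ij(1)] sym[of i a] by (cases "C a a = 0") simp_all
      qed
    next
      case False
      with ij have "i \<in> I" "j \<in> I" by auto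
      with l[OF this] False show ?thesis by (simp add: C'_def)
    qed
    finally show ?thesis by simp
  qed
  then show ?case by blast
qed

interpretation std_normal: prob_space "std_normal_distribution"
  using real_dist_normal_dist by (simp add: real_distribution_def)

lemma distr_std_normal_scale:
  assumes "c \<noteq> 0"
  shows "distr std_normal_distribution borel (\<lambda>x. c * x) = density lborel (normal_density 0 \<bar>c\<bar>)"
proof -
  have "distributed std_normal_distribution lborel (\<lambda>x. x) std_normal_density"
    unfolding distributed_def by (auto intro!: measure_eqI simp: emeasure_distr)
  from std_normal.normal_density_affine[OF this, of c 0] assms
  have "distributed std_normal_distribution lborel (\<lambda>x. c * x) (normal_density 0 \<bar>c\<bar>)" by simp
  then have "distr std_normal_distribution lborel (\<lambda>x. c * x) = density lborel (normal_density 0 \<bar>c\<bar>)"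
    by (simp add: distributed_def)
  then show ?thesis by (simp cong: distr_cong)
qed

lemma distr_std_normal_sqrt:
  assumes "0 < v"
  shows "distr std_normal_distribution borel (\<lambda>x. sqrt v * x) = centered_normal_real v"
  using distr_std_normal_scale[of "sqrt v"] assms by (simp add: centered_normal_real_def)

text \<open>
  If \<open>C = L\<^sup>T L\<close> and \<open>Z\<close> has independent standard normal entries, then \<open>t \<bullet> (L\<^sup>T Z) = \<Sum> c\<^sub>m Z\<^sub>m\<close> with
  \<open>\<Sum> c\<^sub>m\<^sup>2 = t \<bullet> C t\<close>. Only the indices with \<open>c\<^sub>m \<noteq> 0\<close> are kept, since normal densities exist for positive
  variances only; if none remains, the projection is the point mass at \<open>0\<close>.
\<close>

lemma ex_centered_normal:
  fixes C :: "real ^ 'n ^ 'n"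
  assumes sym: "transpose C = C" and psd: "\<And>t. 0 \<le> t \<bullet> (C *v t)"
  shows "\<exists>\<nu>. centered_normal C \<nu> \<and> prob_space \<nu>"
proof -
  have inner_eq: "t \<bullet> (C *v t) = (\<Sum>i\<in>UNIV. \<Sum>j\<in>UNIV. t $ i * t $ j * C $ i $ j)" for t
    by (simp add: inner_vec_def matrix_vector_mult_def sum_distrib_left mult_ac)
  have "\<exists>l :: 'n \<Rightarrow> 'n \<Rightarrow> real. \<forall>i\<in>UNIV. \<forall>j\<in>UNIV. C $ i $ j = (\<Sum>m\<in>UNIV. l m i * l m j)"
  proof (rule positive_semidefinite_factorization)
    show "C $ i $ j = C $ j $ i" for i j using sym by (metis transpose_def vec_lambda_beta)
    show "0 \<le> (\<Sum>i\<in>UNIV. \<Sum>j\<in>UNIV. t i * t j * C $ i $ j)" for t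
      using psd[of "\<chi> i. t i"] by (simp add: inner_eq)
  qed simp
  then obtain l :: "'n \<Rightarrow> 'n \<Rightarrow> real" where l: "\<And>i j. C $ i $ j = (\<Sum>m\<in>UNIV. l m i * l m j)" by auto
  define P where "P = PiM (UNIV :: 'n set) (\<lambda>_. std_normal_distribution)"
  interpret P: prob_space P unfolding P_def by (intro prob_space_PiM std_normal.prob_space_axioms)
  have comp_meas [measurable]: "(\<lambda>x. x m) \<in> borel_measurable P" for m
    unfolding P_def by measurable
  have comp_distr: "distr P borel (\<lambda>x. x m) = std_normal_distribution" for m
  proof -
    have "distr P std_normal_distribution (\<lambda>x. x m) = std_normal_distribution"
      unfolding P_def by (rule distr_PiM_component) (auto intro: std_normal.prob_space_axioms)
    then show ?thesis by (simp cong: distr_cong)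
  qed
  have indep: "P.indep_vars (\<lambda>_. borel) (\<lambda>m x. x m) UNIV"
  proof (subst P.indep_vars_iff_distr_eq_PiM)
    show "distr P (\<Pi>\<^sub>M i\<in>UNIV. borel) (\<lambda>x. \<lambda>i\<in>UNIV. x i) = (\<Pi>\<^sub>M i\<in>UNIV. distr P borel (\<lambda>x. x i))"
    proof -
      have s: "sets P = sets (PiM UNIV (\<lambda>_. borel))" unfolding P_def by (intro sets_PiM_cong) auto
      have "distr P (\<Pi>\<^sub>M i\<in>UNIV. borel) (\<lambda>x. x) = P" by (rule distr_id2) (simp add: s)
      then show ?thesis unfolding comp_distr by (simp add: P_def restrict_UNIV)
    qed
  qed auto
  define \<Phi> :: "('n \<Rightarrow> real) \<Rightarrow> real ^ 'n" where "\<Phi> x = (\<chi> i. \<Sum>m\<in>UNIV. l m i * x m)" for x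
  have [measurable]: "\<Phi> \<in> borel_measurable P"
    by (rule vec_borel_measurableI) (simp add: \<Phi>_def)
  have "distr (distr P borel \<Phi>) borel (\<lambda>x. t \<bullet> x) = centered_normal_real (t \<bullet> (C *v t))" for t
  proof -
    define c where "c m = (\<Sum>i\<in>UNIV. t $ i * l m i)" for m
    define J where "J = {m. c m \<noteq> 0}"
    have "t \<bullet> \<Phi> x = (\<Sum>i\<in>UNIV. \<Sum>m\<in>UNIV. t $ i * l m i * x m)" for x
      by (simp add: inner_vec_def \<Phi>_def sum_distrib_left mult_ac)
    also have "(\<Sum>i\<in>UNIV. \<Sum>m\<in>UNIV. t $ i * l m i * x m) = (\<Sum>m\<in>UNIV. c m * x m)" for x
      by (subst sum.swap) (simp add: c_def sum_distrib_right)
    also have "(\<Sum>m\<in>UNIV. c m * x m) = (\<Sum>m\<in>J. c m * x m)" for x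
      by (rule sum.mono_neutral_right) (auto simp: J_def)
    finally have inner_Phi: "t \<bullet> \<Phi> x = (\<Sum>m\<in>J. c m * x m)" for x .
    have "t \<bullet> (C *v t) = (\<Sum>i\<in>UNIV. \<Sum>j\<in>UNIV. \<Sum>m\<in>UNIV. (t $ i * l m i) * (t $ j * l m j))"
      unfolding inner_eq l by (simp add: sum_distrib_left mult_ac)
    also have "\<dots> = (\<Sum>i\<in>UNIV. \<Sum>m\<in>UNIV. \<Sum>j\<in>UNIV. (t $ i * l m i) * (t $ j * l m j))"
      by (intro sum.cong refl sum.swap)
    also have "\<dots> = (\<Sum>m\<in>UNIV. \<Sum>i\<in>UNIV. \<Sum>j\<in>UNIV. (t $ i * l m i) * (t $ j * l m j))"
      by (rule sum.swap)
    also have "\<dots> = (\<Sum>m\<in>UNIV. (c m)\<^sup>2)"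
      by (simp add: c_def power2_eq_square sum_product)
    also have "\<dots> = (\<Sum>m\<in>J. (c m)\<^sup>2)"
      by (rule sum.mono_neutral_right) (auto simp: J_def)
    finally have quad: "t \<bullet> (C *v t) = (\<Sum>m\<in>J. (c m)\<^sup>2)" .
    have "distr (distr P borel \<Phi>) borel (\<lambda>x. t \<bullet> x) = distr P borel (\<lambda>x. \<Sum>m\<in>J. c m * x m)"
      by (subst distr_distr) (simp_all add: comp_def inner_Phi)
    also have "\<dots> = centered_normal_real (\<Sum>m\<in>J. (c m)\<^sup>2)"
    proof (cases "J = {}")
      case True
      then show ?thesis by (simp add: centered_normal_real_def P.distr_const)
    next
      case False
      have "distributed P lborel (\<lambda>x. \<Sum>m\<in>J. c m * x m)
          (normal_density (\<Sum>m\<in>J. 0) (sqrt (\<Sum>m\<in>J. \<bar>c m\<bar>\<^sup>2)))"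
      proof (rule P.sum_indep_normal)
        show "P.indep_vars (\<lambda>i. borel) (\<lambda>m x. c m * x m) J"
          using P.indep_vars_compose2[OF P.indep_vars_subset[OF indep], of J "\<lambda>m y. c m * y"] by simp
        fix m assume m: "m \<in> J"
        have "distr P borel (\<lambda>x. c m * x m) = distr (distr P borel (\<lambda>x. x m)) borel (\<lambda>y. c m * y)"
          by (subst distr_distr) (simp_all add: comp_def)
        also have "\<dots> = density lborel (normal_density 0 \<bar>c m\<bar>)"
          unfolding comp_distr using m by (intro distr_std_normal_scale) (auto simp: J_def)
        finally show "distributed P lborel (\<lambda>x. c m * x m) (normal_density 0 \<bar>c m\<bar>)"
          by (simp add: distributed_def cong: distr_cong)
      qed (use False in \<open>auto simp: J_def\<close>)
      then have "distr P borel (\<lambda>x. \<Sum>m\<in>J. c m * x m) = density lborel (normal_density 0 (sqrt (\<Sum>m\<in>J. (c m)\<^sup>2)))"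
        by (simp add: distributed_def cong: distr_cong)
      moreover have "(\<Sum>m\<in>J. (c m)\<^sup>2) \<noteq> 0"
        using False sum_pos[of J "\<lambda>m. (c m)\<^sup>2"] by (auto simp: J_def)
      ultimately show ?thesis by (simp add: centered_normal_real_def)
    qed
    finally show ?thesis unfolding quad .
  qed
  then have "centered_normal C (distr P borel \<Phi>)"
    unfolding centered_normal_def using sym psd by simp
  moreover have "prob_space (distr P borel \<Phi>)" by (rule P.prob_space_distr) simp
  ultimately show ?thesis by blast
qed


section \<open>Sums of independent variables\<close>

lemma (in prob_space) indep_vars_Suc:
  assumes "indep_vars (\<lambda>_. N) X {1..}"
  shows "indep_vars (\<lambda>_. N) (\<lambda>n. X (Suc n)) (UNIV :: nat set)"
proof -
  have rv: "\<And>i. i \<ge> 1 \<Longrightarrow> random_variable N (X i)"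
    and ind: "indep_sets (\<lambda>i. {X i -` A \<inter> space M |A. A \<in> sets N}) {1..}"
    using assms unfolding indep_vars_def2 by auto
  have "indep_sets (\<lambda>i. {X (Suc i) -` A \<inter> space M |A. A \<in> sets N}) UNIV"
  proof (rule indep_setsI)
    show "{X (Suc i) -` A \<inter> space M |A. A \<in> sets N} \<subseteq> events" for i
      using rv[of "Suc i"] by (auto intro: measurable_sets)
    fix A J assume J: "J \<noteq> {}" "finite (J :: nat set)"
      and A: "\<forall>j\<in>J. A j \<in> {X (Suc j) -` B \<inter> space M |B. B \<in> sets N}"
    have "prob (\<Inter>j\<in>Suc ` J. A (j - 1)) = (\<Prod>j\<in>Suc ` J. prob (A (j - 1)))"
      by (rule indep_setsD[OF ind]) (use J A in auto)
    then show "prob (\<Inter>j\<in>J. A j) = (\<Prod>j\<in>J. prob (A j))"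
      by (simp add: prod.reindex)
  qed
  then show ?thesis unfolding indep_vars_def2 using rv by auto
qed

lemma (in prob_space) second_moment_indep_sum:
  fixes Z :: "nat \<Rightarrow> 'a \<Rightarrow> real"
  assumes "finite I" "indep_vars (\<lambda>_. borel) Z I"
    and "\<And>i. i \<in> I \<Longrightarrow> integrable M (\<lambda>x. (Z i x)\<^sup>2)" "\<And>i. i \<in> I \<Longrightarrow> expectation (Z i) = 0"
  shows "integrable M (\<lambda>x. (\<Sum>i\<in>I. Z i x)\<^sup>2) \<and>
    expectation (\<lambda>x. (\<Sum>i\<in>I. Z i x)\<^sup>2) = (\<Sum>i\<in>I. expectation (\<lambda>x. (Z i x)\<^sup>2))"
  using assms
proof (induction I rule: finite_induct)
  case empty
  then show ?case by simp
next
  case (insert i I)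
  let ?S = "\<lambda>x. \<Sum>i\<in>I. Z i x"
  have rv: "Z j \<in> borel_measurable M" if "j \<in> insert i I" for j
    using insert.prems(1) that unfolding indep_vars_def2 by auto
  have sq: "integrable M (Z j)" if "j \<in> insert i I" for j
    by (rule square_integrable_imp_integrable[OF rv[OF that] insert.prems(2)[OF that]])
  have IH: "integrable M (\<lambda>x. (?S x)\<^sup>2)" "expectation (\<lambda>x. (?S x)\<^sup>2) = (\<Sum>i\<in>I. expectation (\<lambda>x. (Z i x)\<^sup>2))"
    using insert.IH insert.prems indep_vars_subset[OF insert.prems(1)] by (auto simp: subset_insertI)
  have indep: "indep_var borel (Z i) borel ?S"
    by (rule indep_vars_sum[OF insert.hyps insert.prems(1)])
  have i1: "integrable M (Z i)" and i2: "integrable M ?S" using sq by auto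
  have cross: "integrable M (\<lambda>x. Z i x * ?S x)" "expectation (\<lambda>x. Z i x * ?S x) = 0"
    using indep_var_integrable[OF indep i1 i2] indep_var_lebesgue_integral[OF indep i1 i2] insert.prems(3) by auto
  have eq: "(\<Sum>i\<in>insert i I. Z i x)\<^sup>2 = (Z i x)\<^sup>2 + 2 * (Z i x * ?S x) + (?S x)\<^sup>2" for x
    using insert.hyps by (simp add: power2_sum)
  show ?case unfolding eq using insert.prems(2) insert.hyps cross IH by auto
qed

text \<open>
  The central limit theorem for the test functions that matter here. When \<open>v = 0\<close> all variables vanish
  almost surely; when \<open>v > 0\<close> the univariate theorem applies to the sums normalised by \<open>sqrt (N v)\<close>, and the
  factor \<open>sqrt v\<close> is moved into the test function.
\<close>

lemma (in prob_space) clt_expectation_cos: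
  fixes Z :: "nat \<Rightarrow> 'a \<Rightarrow> real"
  assumes indep: "indep_vars (\<lambda>_. borel) Z {1..}"
    and distr: "\<And>n. n \<ge> 1 \<Longrightarrow> distr M borel (Z n) = \<mu>"
    and sq: "integrable M (\<lambda>x. (Z 1 x)\<^sup>2)" and mean: "expectation (Z 1) = 0"
    and v: "expectation (\<lambda>x. (Z 1 x)\<^sup>2) = v"
  shows "(\<lambda>N. expectation (\<lambda>x. cos ((\<Sum>n=1..N. Z n x) / sqrt N + b)))
           \<longlonglongrightarrow> (\<integral>x. cos (x + b) \<partial>centered_normal_real v)"
proof -
  have rv: "n \<ge> 1 \<Longrightarrow> Z n \<in> borel_measurable M" for n
    using indep unfolding indep_vars_def2 by auto
  have rv1: "Z 1 \<in> borel_measurable M" by (rule rv) simp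
  have transfer: "integrable M (\<lambda>x. f (Z n x)) \<longleftrightarrow> integrable M (\<lambda>x. f (Z 1 x))"
    "expectation (\<lambda>x. f (Z n x)) = expectation (\<lambda>x. f (Z 1 x))"
    if "n \<ge> 1" "f \<in> borel_measurable borel" for n and f :: "real \<Rightarrow> real"
    using integrable_distr_eq[OF rv[OF that(1)] that(2)] integrable_distr_eq[OF rv1 that(2)]
      integral_distr[OF rv[OF that(1)] that(2)] integral_distr[OF rv1 that(2)] distr[OF that(1)] distr[of 1]
    by auto
  have v0: "0 \<le> v" unfolding v[symmetric] by simp
  show ?thesis
  proof (cases "v = 0")
    case True
    have "AE x in M. (Z 1 x)\<^sup>2 = 0"
      using integral_nonneg_eq_0_iff_AE[OF sq] v True by simp
    then have Z1: "AE x in M. Z 1 x = 0" by simp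
    have "AE x in M. Z n x = 0" if "n \<ge> 1" for n
    proof -
      have "AE y in distr M borel (Z n). y = 0"
        unfolding distr[OF that] distr[of 1, symmetric, simplified]
        using Z1 rv1 by (subst AE_distr_iff) auto
      then show ?thesis using rv[OF that] by (subst (asm) AE_distr_iff) auto
    qed
    then have all: "AE x in M. \<forall>n\<in>{1..}. Z n x = 0" by (subst AE_ball_countable) auto
    have "expectation (\<lambda>x. cos ((\<Sum>n=1..N. Z n x) / sqrt N + b)) = expectation (\<lambda>x. cos b)" for N
    proof (rule integral_cong_AE)
      show "AE x in M. cos ((\<Sum>n=1..N. Z n x) / sqrt N + b) = cos b"
        using all by eventually_elim simp
    qed (use rv in measurable)
    then show ?thesis using True
      by (simp add: centered_normal_real_def integral_return prob_space)
  next
    case False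
    with v0 have vpos: "0 < v" by simp
    let ?S = "\<lambda>N x. \<Sum>i<N. Z (Suc i) x"
    have weak: "weak_conv_m (\<lambda>N. distr M borel (\<lambda>x. ?S N x / sqrt (N * (sqrt v)\<^sup>2))) std_normal_distribution"
    proof (rule central_limit_theorem_zero_mean)
      show "indep_vars (\<lambda>i. borel) (\<lambda>n. Z (Suc n)) UNIV" by (rule indep_vars_Suc[OF indep])
      show "expectation (Z (Suc n)) = 0" for n using transfer(2)[of "Suc n" "\<lambda>y. y"] mean by simp
      then show "variance (Z (Suc n)) = (sqrt v)\<^sup>2" for n
        using transfer(2)[of "Suc n" "\<lambda>y. y\<^sup>2"] v vpos by simp
      show "integrable M (\<lambda>x. (Z (Suc n) x)\<^sup>2)" for n
        using transfer(1)[of "Suc n" "\<lambda>y. y\<^sup>2"] sq by simp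
      show "distr M borel (Z (Suc n)) = \<mu>" for n by (rule distr) simp
    qed (use vpos in simp)
    have Smeas [measurable]: "?S N \<in> borel_measurable M" for N using rv by measurable
    have "(\<lambda>N. \<integral>y. cos (sqrt v * y + b) \<partial>distr M borel (\<lambda>x. ?S N x / sqrt (N * (sqrt v)\<^sup>2)))
        \<longlonglongrightarrow> (\<integral>y. cos (sqrt v * y + b) \<partial>std_normal_distribution)"
      by (rule weak_conv_imp_integral_bdd_continuous_conv[where B = 1])
         (auto intro!: weak real_dist_normal_dist real_distribution_distr)
    moreover have "(\<integral>y. cos (sqrt v * y + b) \<partial>distr M borel (\<lambda>x. ?S N x / sqrt (N * (sqrt v)\<^sup>2)))
        = expectation (\<lambda>x. cos ((\<Sum>n=1..N. Z n x) / sqrt N + b))" for N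
    proof -
      have "(\<Sum>n=1..N. Z n x) = ?S N x" for x
        by (rule sum.reindex_bij_witness[of _ Suc "\<lambda>n. n - 1"]) auto
      then show ?thesis using vpos
        by (subst integral_distr) (simp_all add: real_sqrt_mult)
    qed
    moreover have "(\<integral>y. cos (sqrt v * y + b) \<partial>std_normal_distribution) = (\<integral>x. cos (x + b) \<partial>centered_normal_real v)"
      unfolding distr_std_normal_sqrt[OF vpos, symmetric] by (subst integral_distr) simp_all
    ultimately show ?thesis by simp
  qed
qed

text \<open>
  The setting of the delta method. Moments are stated for the first variable and transfer to the others
  through the common law \<open>\<mu>\<close>. The indices start at 1 as for samples.
\<close>

locale iid_square_integrable = prob_space M
  for M :: "'a measure" +
  fixes H :: "nat \<Rightarrow> 'a \<Rightarrow> 'b::euclidean_space" and \<mu> :: "'b measure" and m :: 'b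
  assumes indep: "indep_vars (\<lambda>_. borel) H {1..}"
    and distr_H: "\<And>n. n \<ge> 1 \<Longrightarrow> distr M borel (H n) = \<mu>"
    and square_integrable: "integrable M (\<lambda>x. (norm (H 1 x))\<^sup>2)"
    and mean: "expectation (H 1) = m"
begin

lemma H_measurable: "n \<ge> 1 \<Longrightarrow> H n \<in> borel_measurable M"
  using indep unfolding indep_vars_def2 by auto

lemma sample_mean_measurable [measurable]: "(\<lambda>x. sample_mean N (\<lambda>n. H n x)) \<in> borel_measurable M"
  unfolding sample_mean_def
  by (intro borel_measurable_scaleR borel_measurable_const borel_measurable_sum H_measurable) simp

lemma H_integrable: "integrable M (H 1)"
proof -
  have "integrable M (\<lambda>x. norm (H 1 x))"
    by (rule square_integrable_imp_integrable[OF _ square_integrable]) (use H_measurable in measurable)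
  then show ?thesis by (rule integrable_norm_cancel) (simp add: H_measurable)
qed

lemma
  fixes c :: 'b
  shows proj_indep: "indep_vars (\<lambda>_. borel) (\<lambda>n x. c \<bullet> (H n x - m)) {1..}"
    and proj_distr: "n \<ge> 1 \<Longrightarrow> distr M borel (\<lambda>x. c \<bullet> (H n x - m)) = distr \<mu> borel (\<lambda>y. c \<bullet> (y - m))"
    and proj_square: "n \<ge> 1 \<Longrightarrow> integrable M (\<lambda>x. (c \<bullet> (H n x - m))\<^sup>2)"
    and proj_mean: "n \<ge> 1 \<Longrightarrow> expectation (\<lambda>x. c \<bullet> (H n x - m)) = 0"
    and proj_second_moment: "n \<ge> 1 \<Longrightarrow> expectation (\<lambda>x. (c \<bullet> (H n x - m))\<^sup>2) = expectation (\<lambda>x. (c \<bullet> (H 1 x - m))\<^sup>2)"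
proof -
  let ?p = "\<lambda>y. c \<bullet> (y - m)"
  show "indep_vars (\<lambda>_. borel) (\<lambda>n x. c \<bullet> (H n x - m)) {1..}"
    by (rule indep_vars_compose2[OF indep, of "\<lambda>_. ?p"]) measurable
  \<comment> \<open>All projected variables have the law of \<open>?p\<close> under \<open>\<mu>\<close>, so moments transfer from index 1.\<close>
  show d: "distr M borel (\<lambda>x. c \<bullet> (H n x - m)) = distr \<mu> borel ?p" if "n \<ge> 1" for n
    using H_measurable[OF that] unfolding distr_H[OF that, symmetric]
    by (subst distr_distr) (simp_all add: comp_def)
  have rv: "n \<ge> 1 \<Longrightarrow> (\<lambda>x. c \<bullet> (H n x - m)) \<in> borel_measurable M" for n
    using H_measurable by measurable
  have transfer: "integrable M (\<lambda>x. f (c \<bullet> (H n x - m))) \<longleftrightarrow> integrable (distr \<mu> borel ?p) f"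
    "expectation (\<lambda>x. f (c \<bullet> (H n x - m))) = integral\<^sup>L (distr \<mu> borel ?p) f"
    if "n \<ge> 1" "f \<in> borel_measurable borel" for n and f :: "real \<Rightarrow> real"
    using integrable_distr_eq[OF rv[OF that(1)] that(2)] integral_distr[OF rv[OF that(1)] that(2)] d[OF that(1)]
    by auto
  have sq1: "integrable M (\<lambda>x. (c \<bullet> (H 1 x - m))\<^sup>2)"
  proof (rule Bochner_Integration.integrable_bound)
    show "integrable M (\<lambda>x. (norm c)\<^sup>2 * (2 * (norm (H 1 x))\<^sup>2 + 2 * (norm m)\<^sup>2))"
      using square_integrable by auto
    have "(c \<bullet> (H 1 x - m))\<^sup>2 \<le> (norm c)\<^sup>2 * (2 * (norm (H 1 x))\<^sup>2 + 2 * (norm m)\<^sup>2)" for x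
    proof -
      have "\<bar>c \<bullet> (H 1 x - m)\<bar> \<le> norm c * (norm (H 1 x) + norm m)"
        by (rule order_trans[OF Cauchy_Schwarz_ineq2 mult_left_mono[OF norm_triangle_ineq4]]) simp
      then have "(c \<bullet> (H 1 x - m))\<^sup>2 \<le> (norm c * (norm (H 1 x) + norm m))\<^sup>2"
        by (metis abs_ge_zero power2_abs power_mono)
      also have "\<dots> = (norm c)\<^sup>2 * (norm (H 1 x) + norm m)\<^sup>2" by (simp add: power_mult_distrib)
      also have "\<dots> \<le> (norm c)\<^sup>2 * (2 * (norm (H 1 x))\<^sup>2 + 2 * (norm m)\<^sup>2)"
        using sum_squares_bound[of "norm (H 1 x)" "norm m"] by (intro mult_left_mono) (auto simp: power2_sum)
      finally show ?thesis .
    qed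
    then show "AE x in M. norm ((c \<bullet> (H 1 x - m))\<^sup>2) \<le> norm ((norm c)\<^sup>2 * (2 * (norm (H 1 x))\<^sup>2 + 2 * (norm m)\<^sup>2))"
      by (auto intro!: AE_I2 order_trans[OF _ abs_ge_self])
  qed (use rv[of 1] in measurable)
  have mean1: "expectation (\<lambda>x. c \<bullet> (H 1 x - m)) = 0"
    using H_integrable by (simp add: inner_diff_right mean prob_space del: One_nat_def)
  show "integrable M (\<lambda>x. (c \<bullet> (H n x - m))\<^sup>2)" if "n \<ge> 1" for n
    using transfer(1)[OF that, of "\<lambda>y. y\<^sup>2"] transfer(1)[of 1 "\<lambda>y. y\<^sup>2"] sq1 by simp
  show "expectation (\<lambda>x. c \<bullet> (H n x - m)) = 0" if "n \<ge> 1" for n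
    using transfer(2)[OF that, of "\<lambda>y. y"] transfer(2)[of 1 "\<lambda>y. y"] mean1 by simp
  show "expectation (\<lambda>x. (c \<bullet> (H n x - m))\<^sup>2) = expectation (\<lambda>x. (c \<bullet> (H 1 x - m))\<^sup>2)" if "n \<ge> 1" for n
    using transfer(2)[OF that, of "\<lambda>y. y\<^sup>2"] transfer(2)[of 1 "\<lambda>y. y\<^sup>2"] by simp
qed

definition total_variance :: real where
  "total_variance = expectation (\<lambda>x. (norm (H 1 x - m))\<^sup>2)"

lemma norm_sq_Basis: "(norm y)\<^sup>2 = (\<Sum>b\<in>Basis. (b \<bullet> y)\<^sup>2)" for y :: 'b
  unfolding power2_norm_eq_inner by (subst euclidean_inner) (simp add: power2_eq_square inner_commute)

lemma sample_mean_deviation: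
  assumes "N \<ge> 1"
  shows "sample_mean N (\<lambda>n. H n x) - m = (1 / real N) *\<^sub>R (\<Sum>n=1..N. H n x - m)"
  using assms by (simp add: sample_mean_def sum_subtractf algebra_simps sum_constant_scaleR divide_inverse)

text \<open>
  The mixed terms of \<open>|\<Sum> (H\<^sub>n - m)|\<^sup>2\<close> have expectation \<open>0\<close> by independence. They are treated in
  each coordinate separately, where they are products of real variables.
\<close>

lemma sample_mean_second_moment:
  assumes "N \<ge> 1"
  shows "integrable M (\<lambda>x. (norm (sample_mean N (\<lambda>n. H n x) - m))\<^sup>2)"
    and "expectation (\<lambda>x. (norm (sample_mean N (\<lambda>n. H n x) - m))\<^sup>2) = total_variance / N"
proof -
  have eq: "(norm (sample_mean N (\<lambda>n. H n x) - m))\<^sup>2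
      = (1 / real N)\<^sup>2 * (\<Sum>b\<in>Basis. (\<Sum>n=1..N. b \<bullet> (H n x - m))\<^sup>2)" for x
    unfolding sample_mean_deviation[OF assms] norm_scaleR power_mult_distrib
    by (simp add: norm_sq_Basis inner_sum_right)
  have main: "integrable M (\<lambda>x. (\<Sum>n=1..N. b \<bullet> (H n x - m))\<^sup>2)"
    "expectation (\<lambda>x. (\<Sum>n=1..N. b \<bullet> (H n x - m))\<^sup>2) = N * expectation (\<lambda>x. (b \<bullet> (H 1 x - m))\<^sup>2)" for b
  proof -
    have "integrable M (\<lambda>x. (\<Sum>n\<in>{1..N}. b \<bullet> (H n x - m))\<^sup>2) \<and>
      expectation (\<lambda>x. (\<Sum>n\<in>{1..N}. b \<bullet> (H n x - m))\<^sup>2) = (\<Sum>n\<in>{1..N}. expectation (\<lambda>x. (b \<bullet> (H n x - m))\<^sup>2))"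
      by (rule second_moment_indep_sum)
        (auto simp: proj_square proj_mean intro!: indep_vars_subset[OF proj_indep])
    moreover have "(\<Sum>n\<in>{1..N}. expectation (\<lambda>x. (b \<bullet> (H n x - m))\<^sup>2)) = (\<Sum>n\<in>{1..N}. expectation (\<lambda>x. (b \<bullet> (H 1 x - m))\<^sup>2))"
      by (intro sum.cong refl proj_second_moment) simp
    ultimately show "integrable M (\<lambda>x. (\<Sum>n=1..N. b \<bullet> (H n x - m))\<^sup>2)"
      "expectation (\<lambda>x. (\<Sum>n=1..N. b \<bullet> (H n x - m))\<^sup>2) = N * expectation (\<lambda>x. (b \<bullet> (H 1 x - m))\<^sup>2)"
      by simp_all
  qed
  have tv: "total_variance = (\<Sum>b\<in>Basis. expectation (\<lambda>x. (b \<bullet> (H 1 x - m))\<^sup>2))"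
    unfolding total_variance_def norm_sq_Basis by (rule Bochner_Integration.integral_sum) (simp add: proj_square)
  show "integrable M (\<lambda>x. (norm (sample_mean N (\<lambda>n. H n x) - m))\<^sup>2)"
    unfolding eq using main by auto
  show "expectation (\<lambda>x. (norm (sample_mean N (\<lambda>n. H n x) - m))\<^sup>2) = total_variance / N"
    unfolding eq using main assms
    by (simp add: tv sum_distrib_left[symmetric] power2_eq_square)
qed

lemma prob_sample_mean_deviation:
  assumes "N \<ge> 1" "0 < r"
  shows "prob {x \<in> space M. r \<le> norm (sample_mean N (\<lambda>n. H n x) - m)} \<le> total_variance / (N * r\<^sup>2)"
proof -
  have "prob {x \<in> space M. r\<^sup>2 \<le> (norm (sample_mean N (\<lambda>n. H n x) - m))\<^sup>2}
      \<le> expectation (\<lambda>x. (norm (sample_mean N (\<lambda>n. H n x) - m))\<^sup>2) / r\<^sup>2"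
    by (rule integral_Markov_inequality_measure[OF sample_mean_second_moment(1)[OF assms(1)] sets.empty_sets])
      (use assms in auto)
  moreover have "r\<^sup>2 \<le> (norm y)\<^sup>2 \<longleftrightarrow> r \<le> norm y" for y :: 'b
    using assms(2) by (simp add: abs_le_square_iff[symmetric])
  ultimately show ?thesis
    by (simp add: sample_mean_second_moment(2)[OF assms(1)])
qed

lemma sample_mean_consistent:
  assumes "0 < r"
  shows "(\<lambda>N. prob {x \<in> space M. r \<le> norm (sample_mean N (\<lambda>n. H n x) - m)}) \<longlonglongrightarrow> 0"
proof (rule tendsto_sandwich[OF _ _ tendsto_const])
  show "(\<lambda>N. total_variance / r\<^sup>2 / real N) \<longlonglongrightarrow> 0" by (rule lim_const_over_n)
  show "\<forall>\<^sub>F N in sequentially. prob {x \<in> space M. r \<le> norm (sample_mean N (\<lambda>n. H n x) - m)} \<le> total_variance / r\<^sup>2 / real N"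
    using prob_sample_mean_deviation[OF _ assms]
    by (auto intro!: eventually_sequentiallyI[of 1] simp: mult.commute)
qed simp

end


section \<open>The delta method\<close>

lemma abs_cos_diff_le: "\<bar>cos x - cos y\<bar> \<le> \<bar>x - y\<bar>" for x y :: real
proof -
  have "\<bar>cos x - cos y\<bar> = 2 * \<bar>sin ((x + y) / 2)\<bar> * \<bar>sin ((y - x) / 2)\<bar>"
    by (simp add: cos_diff_cos abs_mult)
  also have "\<dots> \<le> 2 * 1 * \<bar>(y - x) / 2\<bar>"
    by (intro mult_mono abs_sin_x_le_abs_x) auto
  finally show ?thesis by (simp add: abs_minus_commute)
qed

context iid_square_integrable
begin

abbreviation scaled_error :: "nat \<Rightarrow> 'a \<Rightarrow> 'b" where
  "scaled_error N x \<equiv> sqrt (real N) *\<^sub>R (sample_mean N (\<lambda>n. H n x) - m)"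

lemma total_variance_nonneg: "0 \<le> total_variance"
  unfolding total_variance_def by simp

lemma scaled_error_tail:
  assumes "N \<ge> 1" "0 < r"
  shows "prob {x \<in> space M. r \<le> norm (scaled_error N x)} \<le> total_variance / r\<^sup>2"
proof -
  have "r \<le> norm (sqrt (real N) *\<^sub>R y) \<longleftrightarrow> r / sqrt N \<le> norm y" for y :: 'b
    using assms by (simp add: field_simps)
  moreover have "real N * (r / sqrt N)\<^sup>2 = r\<^sup>2"
    using assms by (simp add: power_divide)
  ultimately show ?thesis
    using prob_sample_mean_deviation[OF assms(1), of "r / sqrt N"] assms by simp
qed

text \<open>
  The second moment of the scaled error is the same for all \<open>N \<ge> 1\<close>, so Chebyshev's inequality gives one
  radius for all sample sizes.
\<close>

lemma scaled_error_tight: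
  assumes "0 < e"
  obtains r where "0 < r" "\<And>N. N \<ge> 1 \<Longrightarrow> prob {x \<in> space M. r \<le> norm (scaled_error N x)} \<le> e"
proof
  let ?r = "sqrt ((total_variance + 1) / e)"
  have tv: "0 < total_variance + 1" using total_variance_nonneg by simp
  show r: "0 < ?r" using tv assms by simp
  have "total_variance / ?r\<^sup>2 \<le> e"
    using tv assms total_variance_nonneg by (simp add: field_simps)
  then show "prob {x \<in> space M. ?r \<le> norm (scaled_error N x)} \<le> e" if "N \<ge> 1" for N
    using scaled_error_tail[OF that r] by linarith
qed

text \<open>
  Consistency in the form needed for existence of the estimator: by continuity, \<open>g\<close> maps a neighbourhood
  of \<open>m\<close> into \<open>U\<close>, and the sample mean lies in it with probability tending to \<open>1\<close>.
\<close>

lemma sample_mean_image_consistent: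
  fixes g :: "'b \<Rightarrow> 'c::euclidean_space"
  assumes [measurable]: "g \<in> borel_measurable borel" and "isCont g m" "open U" "g m \<in> U"
  shows "(\<lambda>N. prob {x \<in> space M. g (sample_mean N (\<lambda>n. H n x)) \<in> U}) \<longlonglongrightarrow> 1"
proof -
  have [measurable]: "U \<in> sets borel" using assms(3) by simp
  have "\<forall>\<^sub>F y in nhds m. g y \<in> U"
    using topological_tendstoD[OF _ assms(3,4)] assms(2)
    unfolding isCont_def tendsto_at_iff_tendsto_nhds by blast
  then obtain r where r: "0 < r" "\<And>y. dist y m < r \<Longrightarrow> g y \<in> U"
    unfolding eventually_nhds_metric by blast
  let ?far = "\<lambda>N. {x \<in> space M. r \<le> norm (sample_mean N (\<lambda>n. H n x) - m)}"
  have "(\<lambda>N. 1 - prob (?far N)) \<longlonglongrightarrow> 1 - 0"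
    by (intro tendsto_intros sample_mean_consistent r(1))
  then have lim: "(\<lambda>N. 1 - prob (?far N)) \<longlonglongrightarrow> 1" by simp
  have "1 - prob (?far N) \<le> prob {x \<in> space M. g (sample_mean N (\<lambda>n. H n x)) \<in> U}" for N
  proof -
    have "1 - prob (?far N) = prob (space M - ?far N)"
      by (rule prob_compl[symmetric]) measurable
    also have "\<dots> \<le> prob {x \<in> space M. g (sample_mean N (\<lambda>n. H n x)) \<in> U}"
      using r(2) by (intro finite_measure_mono) (auto simp: dist_norm)
    finally show ?thesis .
  qed
  then show ?thesis
    by (intro tendsto_sandwich[OF _ _ lim tendsto_const]) (auto intro!: always_eventually)
qed

text \<open>
  Near \<open>m\<close> the remainder of the linearisation is at most \<open>e / r\<close> times the deviation from \<open>m\<close>. After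
  scaling by \<open>sqrt N\<close> it can therefore reach \<open>e\<close> only if the scaled error reaches \<open>r\<close>, which is unlikely
  uniformly in \<open>N\<close> when \<open>r\<close> is large, or if the sample mean is far from \<open>m\<close>, which becomes unlikely.
\<close>

lemma delta_remainder:
  fixes g :: "'b \<Rightarrow> 'c::euclidean_space"
  assumes [measurable]: "g \<in> borel_measurable borel" and g: "(g has_derivative G) (at m)" and e: "0 < e"
  shows "(\<lambda>N. prob {x \<in> space M. e \<le> norm (sqrt (real N) *\<^sub>R (g (sample_mean N (\<lambda>n. H n x)) - g m)
            - G (scaled_error N x))}) \<longlonglongrightarrow> 0"
proof (rule tendstoI)
  fix d :: real assume d: "0 < d"
  interpret G: bounded_linear G using g by (rule has_derivative_bounded_linear)
  have [measurable]: "G \<in> borel_measurable borel"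
    by (rule borel_measurable_continuous_onI[OF linear_continuous_on[OF G.bounded_linear_axioms]])
  obtain r where r: "0 < r" "\<And>N. N \<ge> 1 \<Longrightarrow> prob {x \<in> space M. r \<le> norm (scaled_error N x)} \<le> d / 2"
    using scaled_error_tight[of "d / 2"] d by auto
  obtain \<delta> where \<delta>: "0 < \<delta>" "\<And>y. norm (y - m) < \<delta> \<Longrightarrow> norm (g y - g m - G (y - m)) \<le> e / r * norm (y - m)"
    using g e r(1) unfolding has_derivative_at_alt by (meson divide_pos_pos)
  let ?far = "\<lambda>N. {x \<in> space M. \<delta> \<le> norm (sample_mean N (\<lambda>n. H n x) - m)}"
  let ?big = "\<lambda>N. {x \<in> space M. r \<le> norm (scaled_error N x)}"
  let ?bad = "\<lambda>N. {x \<in> space M. e \<le> norm (sqrt (real N) *\<^sub>R (g (sample_mean N (\<lambda>n. H n x)) - g m) - G (scaled_error N x))}"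
  have sub: "?bad N \<subseteq> ?far N \<union> ?big N" for N
  proof
    fix x assume x: "x \<in> ?bad N"
    define y where "y = sample_mean N (\<lambda>n. H n x)"
    have "r \<le> norm (sqrt (real N) *\<^sub>R (y - m))" if "norm (y - m) < \<delta>"
    proof -
      have "e \<le> norm (sqrt (real N) *\<^sub>R (g y - g m) - G (sqrt (real N) *\<^sub>R (y - m)))"
        using x by (simp add: y_def)
      also have "\<dots> = sqrt (real N) * norm (g y - g m - G (y - m))"
        by (simp add: G.scaleR scaleR_diff_right[symmetric])
      also have "\<dots> \<le> sqrt (real N) * (e / r * norm (y - m))"
        by (intro mult_left_mono \<delta>(2) that) simp
      finally have "e * r \<le> e * (sqrt (real N) * norm (y - m))"
        using r(1) by (simp add: field_simps)
      then show ?thesis using e by simp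
    qed
    then show "x \<in> ?far N \<union> ?big N" using x by (fastforce simp: y_def)
  qed
  have "\<forall>\<^sub>F N in sequentially. dist (prob (?far N)) 0 < d / 2"
    by (intro tendstoD sample_mean_consistent \<delta>(1)) (simp add: d)
  then show "\<forall>\<^sub>F N in sequentially. dist (prob (?bad N)) 0 < d"
    using eventually_ge_at_top[of 1]
  proof eventually_elim
    case (elim N)
    have "prob (?bad N) \<le> prob (?far N \<union> ?big N)"
      by (rule finite_measure_mono[OF sub]) measurable
    also have "\<dots> \<le> prob (?far N) + prob (?big N)"
      by (rule measure_Un_le) measurable
    finally show ?case using elim(1) r(2)[OF elim(2)] by simp
  qed
qed

text \<open>
  For a wave with frequency \<open>t\<close> the linearised error \<open>G (scaled_error N)\<close> enters through
  \<open>t \<bullet> G z = c \<bullet> z\<close> with \<open>c\<close> the image of \<open>t\<close> under the adjoint of \<open>G\<close>. This is a normalised sum of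
  independent real variables, so the univariate limit theorem applies. The remainder \<open>D\<close> tends to \<open>0\<close> in
  probability and cosine is bounded and 1-Lipschitz, so passing to the actual error does not change the
  limit. Tightness is inherited from the scaled error because \<open>G\<close> is bounded.
\<close>

theorem delta_method:
  fixes g :: "'b \<Rightarrow> 'c::euclidean_space"
  assumes g_meas [measurable]: "g \<in> borel_measurable borel" and g: "(g has_derivative G) (at m)"
    and \<nu>: "prob_space \<nu>" "sets \<nu> = sets borel"
    and normal: "\<And>t. distr \<nu> borel (\<lambda>y. t \<bullet> y) = centered_normal_real (expectation (\<lambda>x. (t \<bullet> G (H 1 x - m))\<^sup>2))"
  shows "converges_in_law (\<lambda>N. distr M borel (\<lambda>x. sqrt (real N) *\<^sub>R (g (sample_mean N (\<lambda>n. H n x)) - g m))) \<nu>"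
proof -
  interpret G: bounded_linear G using g by (rule has_derivative_bounded_linear)
  have [measurable]: "G \<in> borel_measurable borel"
    by (rule borel_measurable_continuous_onI[OF linear_continuous_on[OF G.bounded_linear_axioms]])
  define W where "W N x = sqrt (real N) *\<^sub>R (g (sample_mean N (\<lambda>n. H n x)) - g m)" for N x
  define D where "D N x = W N x - G (scaled_error N x)" for N x
  have [measurable]: "W N \<in> borel_measurable M" for N unfolding W_def by measurable
  have [measurable]: "D N \<in> borel_measurable M" for N unfolding D_def by measurable
  have D: "(\<lambda>N. prob {x \<in> space M. e \<le> norm (D N x)}) \<longlonglongrightarrow> 0" if "0 < e" for e
    using delta_remainder[OF g_meas g that] by (simp add: D_def W_def)
  have int_cos: "integrable M (\<lambda>x. cos (f x))" if [measurable]: "f \<in> borel_measurable M" for f :: "'a \<Rightarrow> real"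
    by (rule integrable_const_bound[of _ 1]) auto
  have "converges_in_law (\<lambda>N. distr M borel (W N)) \<nu>"
  proof (rule converges_in_law_if_cos)
    fix t :: 'c and b :: real
    define c where "c = adjoint G t"
    have c: "c \<bullet> z = t \<bullet> G z" for z
      unfolding c_def by (rule adjoint_clauses(2)[OF G.linear_axioms])
    let ?v = "expectation (\<lambda>x. (c \<bullet> (H 1 x - m))\<^sup>2)"
    have "(\<lambda>N. expectation (\<lambda>x. cos ((\<Sum>n=1..N. c \<bullet> (H n x - m)) / sqrt N + b)))
        \<longlonglongrightarrow> (\<integral>x. cos (x + b) \<partial>centered_normal_real ?v)"
      by (rule clt_expectation_cos[OF proj_indep proj_distr proj_square proj_mean refl]) auto
    also have "(\<integral>x. cos (x + b) \<partial>centered_normal_real ?v) = (\<integral>y. cos (t \<bullet> y + b) \<partial>\<nu>)"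
      unfolding c normal[of t, symmetric] using \<nu>(2)
      by (subst integral_distr) (auto simp: measurable_cong_sets[OF \<nu>(2)])
    finally have lim: "(\<lambda>N. expectation (\<lambda>x. cos ((\<Sum>n=1..N. c \<bullet> (H n x - m)) / sqrt N + b)))
        \<longlonglongrightarrow> (\<integral>y. cos (t \<bullet> y + b) \<partial>\<nu>)" .
    have lin: "(\<Sum>n=1..N. c \<bullet> (H n x - m)) / sqrt N = t \<bullet> G (scaled_error N x)" if "N \<ge> 1" for N x
      unfolding c[symmetric] sample_mean_deviation[OF that]
      using that by (simp add: inner_sum_right field_simps real_sqrt_mult_self)
    have "(\<lambda>N. expectation (\<lambda>x. cos (t \<bullet> W N x + b)) - expectation (\<lambda>x. cos (t \<bullet> G (scaled_error N x) + b))) \<longlonglongrightarrow> 0"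
    proof (rule tendstoI)
      fix d :: real assume d: "0 < d"
      define e where "e = d / (2 * (norm t + 1))"
      have nt: "0 < norm t + 1" by (simp add: add_nonneg_pos)
      have e: "0 < e" "norm t * e \<le> d / 2"
        using d nt by (auto simp: e_def field_simps)
      let ?bad = "\<lambda>N. {x \<in> space M. e \<le> norm (D N x)}"
      have "\<forall>\<^sub>F N in sequentially. dist (prob (?bad N)) 0 < d / 4"
        by (intro tendstoD D e(1)) (simp add: d)
      then show "\<forall>\<^sub>F N in sequentially. dist (expectation (\<lambda>x. cos (t \<bullet> W N x + b))
          - expectation (\<lambda>x. cos (t \<bullet> G (scaled_error N x) + b))) 0 < d"
      proof eventually_elim
        case (elim N)
        have i: "integrable M (\<lambda>x. cos (t \<bullet> W N x + b))" "integrable M (\<lambda>x. cos (t \<bullet> G (scaled_error N x) + b))"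
          by (auto intro!: int_cos)
        have bi: "integrable M (indicator (?bad N) :: _ \<Rightarrow> real)"
          by (rule integrable_const_bound[of _ 1]) auto
        have "\<bar>expectation (\<lambda>x. cos (t \<bullet> W N x + b)) - expectation (\<lambda>x. cos (t \<bullet> G (scaled_error N x) + b))\<bar>
            = \<bar>expectation (\<lambda>x. cos (t \<bullet> W N x + b) - cos (t \<bullet> G (scaled_error N x) + b))\<bar>"
          using i by simp
        also have "\<dots> \<le> expectation (\<lambda>x. \<bar>cos (t \<bullet> W N x + b) - cos (t \<bullet> G (scaled_error N x) + b)\<bar>)"
          by (rule integral_abs_bound)
        also have "\<dots> \<le> expectation (\<lambda>x. norm t * e + 2 * indicator (?bad N) x)"
        proof (rule integral_mono)
          show "integrable M (\<lambda>x. \<bar>cos (t \<bullet> W N x + b) - cos (t \<bullet> G (scaled_error N x) + b)\<bar>)" using i by auto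
          show "integrable M (\<lambda>x. norm t * e + 2 * indicator (?bad N) x)" using bi by auto
          fix x assume x: "x \<in> space M"
          have two: "\<bar>cos (t \<bullet> W N x + b) - cos (t \<bullet> G (scaled_error N x) + b)\<bar> \<le> 2"
            using abs_triangle_ineq4[of "cos (t \<bullet> W N x + b)" "cos (t \<bullet> G (scaled_error N x) + b)"]
              abs_cos_le_one[of "t \<bullet> W N x + b"] abs_cos_le_one[of "t \<bullet> G (scaled_error N x) + b"] by linarith
          have "\<bar>cos (t \<bullet> W N x + b) - cos (t \<bullet> G (scaled_error N x) + b)\<bar>
              \<le> \<bar>(t \<bullet> W N x + b) - (t \<bullet> G (scaled_error N x) + b)\<bar>" by (rule abs_cos_diff_le)
          also have "(t \<bullet> W N x + b) - (t \<bullet> G (scaled_error N x) + b) = t \<bullet> D N x"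
            by (simp add: D_def inner_diff_right)
          also have "\<bar>t \<bullet> D N x\<bar> \<le> norm t * norm (D N x)" by (rule Cauchy_Schwarz_ineq2)
          finally have "\<bar>cos (t \<bullet> W N x + b) - cos (t \<bullet> G (scaled_error N x) + b)\<bar> \<le> norm t * norm (D N x)" .
          moreover have "norm t * norm (D N x) \<le> norm t * e" if "norm (D N x) < e"
            using that by (intro mult_left_mono) auto
          moreover have "0 \<le> norm t * e" using e by simp
          ultimately show "\<bar>cos (t \<bullet> W N x + b) - cos (t \<bullet> G (scaled_error N x) + b)\<bar>
              \<le> norm t * e + 2 * indicator (?bad N) x"
            using two x by (cases "e \<le> norm (D N x)") auto
        qed
        also have "\<dots> = norm t * e + 2 * prob (?bad N)"
          using bi by (simp add: prob_space)
        finally show ?case using elim e(2) by simp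
      qed
    qed
    moreover have "(\<lambda>N. expectation (\<lambda>x. cos (t \<bullet> G (scaled_error N x) + b))) \<longlonglongrightarrow> (\<integral>y. cos (t \<bullet> y + b) \<partial>\<nu>)"
      by (rule Lim_transform_eventually[OF lim]) (rule eventually_sequentiallyI[of 1], simp only: lin)
    ultimately have "(\<lambda>N. expectation (\<lambda>x. cos (t \<bullet> W N x + b))) \<longlonglongrightarrow> (\<integral>y. cos (t \<bullet> y + b) \<partial>\<nu>)"
      by (rule Lim_transform[rotated])
    then show "(\<lambda>N. \<integral>y. cos (t \<bullet> y + b) \<partial>distr M borel (W N)) \<longlonglongrightarrow> (\<integral>y. cos (t \<bullet> y + b) \<partial>\<nu>)"
      by (simp add: integral_distr)
  next
    fix e :: real assume e: "0 < e"
    obtain K where K: "0 < K" "\<And>y. norm (G y) \<le> norm y * K" using G.pos_bounded by blast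
    obtain r where r: "0 < r" "\<And>N. N \<ge> 1 \<Longrightarrow> prob {x \<in> space M. r \<le> norm (scaled_error N x)} \<le> e / 2"
      using scaled_error_tight[of "e / 2"] e by auto
    have "\<forall>\<^sub>F N in sequentially. dist (prob {x \<in> space M. 1 \<le> norm (D N x)}) 0 < e / 2"
      by (intro tendstoD D) (simp_all add: e)
    then have "\<forall>\<^sub>F N in sequentially. measure (distr M borel (W N)) {y. r * K + 1 < norm y} \<le> e"
      using eventually_ge_at_top[of 1]
    proof eventually_elim
      case (elim N)
      have "measure (distr M borel (W N)) {y. r * K + 1 < norm y} = prob (W N -` {y. r * K + 1 < norm y} \<inter> space M)"
        by (rule measure_distr) measurable
      also have "\<dots> \<le> prob ({x \<in> space M. r \<le> norm (scaled_error N x)} \<union> {x \<in> space M. 1 \<le> norm (D N x)})"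
      proof (rule finite_measure_mono)
        show "W N -` {y. r * K + 1 < norm y} \<inter> space M
            \<subseteq> {x \<in> space M. r \<le> norm (scaled_error N x)} \<union> {x \<in> space M. 1 \<le> norm (D N x)}"
        proof
          fix x assume x: "x \<in> W N -` {y. r * K + 1 < norm y} \<inter> space M"
          have "W N x = D N x + G (scaled_error N x)" by (simp add: D_def)
          then have "norm (W N x) \<le> norm (D N x) + norm (scaled_error N x) * K"
            using norm_triangle_ineq[of "D N x" "G (scaled_error N x)"] K(2)[of "scaled_error N x"] by simp
          moreover have "norm (scaled_error N x) * K \<le> r * K" if "norm (scaled_error N x) < r"
            using that K(1) by (intro mult_right_mono) auto
          ultimately show "x \<in> {x \<in> space M. r \<le> norm (scaled_error N x)} \<union> {x \<in> space M. 1 \<le> norm (D N x)}"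
            using x by force
        qed
      qed measurable
      also have "\<dots> \<le> prob {x \<in> space M. r \<le> norm (scaled_error N x)} + prob {x \<in> space M. 1 \<le> norm (D N x)}"
        by (rule measure_Un_le) measurable
      also have "\<dots> \<le> e" using elim(1) r(2)[OF elim(2)] by simp
      finally show ?case .
    qed
    then show "\<exists>R. \<forall>\<^sub>F N in sequentially. measure (distr M borel (W N)) {y. R < norm y} \<le> e" by blast
  qed (auto intro!: prob_space_distr \<nu>)
  then show ?thesis by (simp add: W_def[abs_def])
qed

end

section \<open>Inversion of the first two moments\<close>

lemma sum_UNIV_Plus:
  "(\<Sum>j\<in>UNIV. f j) = (\<Sum>i\<in>UNIV. f (Inl i)) + (\<Sum>i\<in>UNIV. f (Inr i))"
  for f :: "'a::finite + 'b::finite \<Rightarrow> 'c::comm_monoid_add"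
  unfolding UNIV_Plus_UNIV[symmetric] by (subst sum.Plus) auto

text \<open>
  Here \<open>p\<close> and \<open>q\<close> are the first two moments of a coordinate with parameter \<open>a\<close>, and \<open>A\<close> is the sum of
  all parameters.
\<close>

context
  fixes a A p q :: real
  assumes a: "0 < a" "a < A" and p: "p = a / A" and q: "q = a * (a + 1) / (A * (A + 1))"
begin

lemma concentration_nonzero: "A \<noteq> 0" "A + 1 \<noteq> 0"
  using a by auto

lemma coordinate_variance: "q - p\<^sup>2 = a * (A - a) / (A\<^sup>2 * (A + 1))"
  using concentration_nonzero unfolding p q by (simp add: divide_simps power2_eq_square) (simp add: algebra_simps)

lemma coordinate_variance_pos: "0 < q - p\<^sup>2"
  unfolding coordinate_variance using a by simp

lemma moment_inversion: "p * (p - q) / (q - p\<^sup>2) = a"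
proof -
  have *: "p - q = a * (A - a) / (A * (A + 1))"
    using concentration_nonzero unfolding p q by (simp add: divide_simps) (simp add: algebra_simps)
  show ?thesis
    unfolding * coordinate_variance unfolding p
    using a concentration_nonzero by (simp add: divide_simps power2_eq_square)
qed

text \<open>
  With numerator \<open>N\<close> and denominator \<open>D\<close> of the estimator, \<open>N = a D\<close> at the moments, so the quotient rule
  simplifies to \<open>(N' - a D') / D\<close>; the two coefficients are then evaluated with the closed form of \<open>D\<close>. The
  linear maps \<open>u\<close> and \<open>v\<close> pick the two entries of the vector of moments that belong to one coordinate.
\<close>

lemma moment_inversion_has_derivative:
  fixes u v :: "'z::real_normed_vector \<Rightarrow> real"
  assumes u: "bounded_linear u" and v: "bounded_linear v" and uv: "u z = p" "v z = q"
  shows "((\<lambda>y. u y * (u y - v y) / (v y - (u y)\<^sup>2)) has_derivative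
    (\<lambda>h. A / (A - a) * (2 * A + 1) * (a + 1) * u h - A / (A - a) * (A + 1)\<^sup>2 * v h)) (at z)"
proof -
  let ?D = "q - p\<^sup>2"
  have D0: "?D \<noteq> 0" using coordinate_variance_pos by simp
  have N: "p * (p - q) = a * ?D" using moment_inversion D0 by (simp add: field_simps)
  have combine: "((s * (p - q) + p * (s - t)) * E - a * E * (t - 2 * p * s)) / (E * E)
      = (2 * p - q + 2 * a * p) / E * s - (p + a) / E * t" if "E \<noteq> 0" for s t E
    using that by (simp add: divide_simps) (simp add: algebra_simps)
  have "((\<lambda>y. u y * (u y - v y) / (v y - (u y)\<^sup>2)) has_derivative
    (\<lambda>h. ((u h * (p - q) + p * (u h - v h)) * ?D - p * (p - q) * (v h - 2 * p * u h)) / (?D * ?D))) (at z)"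
    using D0 by (auto intro!: derivative_eq_intros bounded_linear.has_derivative[OF u] bounded_linear.has_derivative[OF v]
      simp: uv algebra_simps)
  moreover have "((u h * (p - q) + p * (u h - v h)) * ?D - p * (p - q) * (v h - 2 * p * u h)) / (?D * ?D)
      = A / (A - a) * (2 * A + 1) * (a + 1) * u h - A / (A - a) * (A + 1)\<^sup>2 * v h" for h
  proof -
    have "((u h * (p - q) + p * (u h - v h)) * ?D - p * (p - q) * (v h - 2 * p * u h)) / (?D * ?D)
        = (2 * p - q + 2 * a * p) / ?D * u h - (p + a) / ?D * v h"
      unfolding N by (rule combine[OF D0])
    also have "(2 * p - q + 2 * a * p) / ?D = A / (A - a) * (2 * A + 1) * (a + 1)"
    proof -
      have *: "2 * p - q + 2 * a * p = a * (a + 1) * (2 * A + 1) / (A * (A + 1))"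
        using concentration_nonzero unfolding p q by (simp add: divide_simps) (simp add: algebra_simps)
      show ?thesis unfolding * coordinate_variance
        using a concentration_nonzero by (simp add: divide_simps power2_eq_square)
    qed
    also have "(p + a) / ?D = A / (A - a) * (A + 1)\<^sup>2"
    proof -
      have *: "p + a = a * (A + 1) / A" using concentration_nonzero unfolding p by (simp add: field_simps)
      show ?thesis unfolding * coordinate_variance
        using a concentration_nonzero by (simp add: divide_simps power2_eq_square)
    qed
    finally show ?thesis .
  qed
  ultimately show ?thesis by simp
qed

end

section \<open>Covariance matrices as quadratic forms\<close>

lemma transpose_covariance_matrix: "transpose (covariance_matrix P h) = covariance_matrix P h"
  by (simp add: covariance_matrix_def transpose_def mult.commute)

lemma covariance_quadratic_form:
  fixes h :: "'x \<Rightarrow> real ^ 'm"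
  assumes "prob_space P" and [measurable]: "\<And>i. (\<lambda>x. h x $ i) \<in> borel_measurable P"
    and sq: "\<And>i. integrable P (\<lambda>x. (h x $ i)\<^sup>2)" and m: "\<And>i. m $ i = (\<integral>x. h x $ i \<partial>P)"
  shows "c \<bullet> (covariance_matrix P h *v c) = (\<integral>x. (c \<bullet> (h x - m))\<^sup>2 \<partial>P)"
proof -
  interpret prob_space P by fact
  have int: "integrable P (\<lambda>x. h x $ i)" for i
    by (rule square_integrable_imp_integrable[OF _ sq]) simp
  have sq': "integrable P (\<lambda>x. (h x $ i - m $ i)\<^sup>2)" for i
    unfolding power2_diff using sq int by auto
  have prod: "integrable P (\<lambda>x. (h x $ i - m $ i) * (h x $ j - m $ j))" for i j
  proof (rule Bochner_Integration.integrable_bound)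
    show "integrable P (\<lambda>x. (h x $ i - m $ i)\<^sup>2 + (h x $ j - m $ j)\<^sup>2)" using sq' by auto
    have "\<bar>y * z\<bar> \<le> y\<^sup>2 + z\<^sup>2" for y z :: real
    proof -
      have "0 \<le> \<bar>y\<bar> * \<bar>z\<bar>" by simp
      moreover have "2 * (\<bar>y\<bar> * \<bar>z\<bar>) \<le> y\<^sup>2 + z\<^sup>2"
        using sum_squares_bound[of "\<bar>y\<bar>" "\<bar>z\<bar>"] by simp
      ultimately show ?thesis unfolding abs_mult by linarith
    qed
    then show "AE x in P. norm ((h x $ i - m $ i) * (h x $ j - m $ j)) \<le> norm ((h x $ i - m $ i)\<^sup>2 + (h x $ j - m $ j)\<^sup>2)"
      by simp
  qed measurable
  have "(c \<bullet> (h x - m))\<^sup>2 = (\<Sum>i\<in>UNIV. \<Sum>j\<in>UNIV. c $ i * c $ j * ((h x $ i - m $ i) * (h x $ j - m $ j)))" for x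
    by (simp add: inner_vec_def power2_eq_square sum_product mult_ac)
  then have "(\<integral>x. (c \<bullet> (h x - m))\<^sup>2 \<partial>P)
      = (\<Sum>i\<in>UNIV. \<Sum>j\<in>UNIV. c $ i * c $ j * (\<integral>x. (h x $ i - m $ i) * (h x $ j - m $ j) \<partial>P))"
    using prod by (simp add: Bochner_Integration.integral_sum)
  also have "\<dots> = c \<bullet> (covariance_matrix P h *v c)"
    by (simp add: inner_vec_def matrix_vector_mult_def covariance_matrix_def m sum_distrib_left mult_ac)
  finally show ?thesis by simp
qed

lemma inner_congruence: "t \<bullet> ((B ** V ** transpose B) *v t) = (transpose B *v t) \<bullet> (V *v (transpose B *v t))"
  for B :: "real ^ 'm ^ 'n" and V :: "real ^ 'm ^ 'm"
  by (metis dot_lmul_matrix inner_commute matrix_vector_mul_assoc transpose_matrix_vector)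

lemma transpose_congruence: "transpose V = V \<Longrightarrow> transpose (B ** V ** transpose B) = B ** V ** transpose B"
  for B :: "real ^ 'm ^ 'n" and V :: "real ^ 'm ^ 'm"
  by (simp add: matrix_transpose_mul matrix_mul_assoc)

section \<open>The Dirichlet moment estimator\<close>

lemma mom_G_mult_nth:
  fixes \<alpha> :: "real ^ 'k"
  defines "A \<equiv> \<Sum>i\<in>UNIV. \<alpha> $ i"
  shows "(mom_G \<alpha> *v y) $ i = A / (A - \<alpha> $ i) * (2 * A + 1) * (\<alpha> $ i + 1) * y $ Inl i
    - A / (A - \<alpha> $ i) * (A + 1)\<^sup>2 * y $ Inr i"
  by (simp add: matrix_vector_mult_def mom_G_def sum_UNIV_Plus Let_def A_def if_distrib[of "\<lambda>x. x * _"] cong: if_cong)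

lemma mom_g_has_derivative:
  fixes \<alpha> :: "real ^ 'k" and m :: "real ^ ('k + 'k)"
  defines "A \<equiv> \<Sum>i\<in>UNIV. \<alpha> $ i"
  assumes \<alpha>: "\<And>i. 0 < \<alpha> $ i" "\<And>i. \<alpha> $ i < A"
    and m: "\<And>i. m $ Inl i = \<alpha> $ i / A" "\<And>i. m $ Inr i = \<alpha> $ i * (\<alpha> $ i + 1) / (A * (A + 1))"
  shows "(mom_g has_derivative (\<lambda>y. mom_G \<alpha> *v y)) (at m)" and "mom_g m = \<alpha>"
proof -
  show "mom_g m = \<alpha>"
    using moment_inversion[OF \<alpha> refl refl] by (simp add: mom_g_def vec_eq_iff m)
  have "((\<lambda>y. mom_g y $ i) has_derivative (\<lambda>y. (mom_G \<alpha> *v y) $ i)) (at m)" for i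
    unfolding mom_G_mult_nth A_def[symmetric] mom_g_def vec_lambda_beta
    by (rule moment_inversion_has_derivative[OF \<alpha> m]) (auto intro: bounded_linear_vec_nth)
  then show "(mom_g has_derivative (\<lambda>y. mom_G \<alpha> *v y)) (at m)"
    by (subst has_derivative_componentwise_within) (auto simp: Basis_vec_def inner_axis)
qed

lemma mom_h_nth [simp]: "mom_h x $ Inl i = x $ i" "mom_h x $ Inr i = (x $ i)\<^sup>2"
  by (simp_all add: mom_h_def)

lemma mom_g_sample_mean: "moment_estimator N x = mom_g (sample_mean N (\<lambda>n. mom_h (x n)))"
  by (simp add: moment_estimator_def mom_g_def sample_mean_def vec_eq_iff Let_def)


lemma mom_h_measurable: "mom_h \<in> borel_measurable borel"
proof (rule vec_borel_measurableI)
  fix j :: "'a + 'a"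
  show "(\<lambda>x. mom_h x $ j) \<in> borel_measurable borel" by (cases j) simp_all
qed

lemma mom_g_measurable: "mom_g \<in> borel_measurable borel"
  unfolding mom_g_def by (rule vec_borel_measurableI) simp

context
  fixes \<alpha> :: "real ^ 'k::{finite,linorder}"
  assumes k: "CARD('k) \<ge> 2" and \<alpha>: "\<alpha> \<in> dirichlet_params"
begin

interpretation prob_space "dirichlet \<alpha>" by (rule prob_space_dirichlet[OF k \<alpha>])

lemma mom_h_square_integrable: "integrable (dirichlet \<alpha>) (\<lambda>x. (mom_h x $ j)\<^sup>2)"
  using integral_dirichlet_power(1)[OF k \<alpha>, of _ 2] integral_dirichlet_power(1)[OF k \<alpha>, of _ "2 * 2"]
  by (cases j) (simp_all add: power_mult[symmetric])

lemma norm_mom_h_square_integrable: "integrable (dirichlet \<alpha>) (\<lambda>x. (norm (mom_h x))\<^sup>2)"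
proof -
  have "(norm (mom_h x))\<^sup>2 = (\<Sum>j\<in>UNIV. (mom_h x $ j)\<^sup>2)" for x :: "real ^ ('k::{finite,linorder})"
    unfolding power2_norm_eq_inner inner_vec_def by (simp add: power2_eq_square)
  then show ?thesis using mom_h_square_integrable by simp
qed

lemma mom_h_integrable: "integrable (dirichlet \<alpha>) mom_h"
proof -
  have [measurable]: "mom_h \<in> borel_measurable (dirichlet \<alpha>)"
    using mom_h_measurable by (simp add: measurable_cong_sets[OF sets_dirichlet refl])
  have "integrable (dirichlet \<alpha>) (\<lambda>x. norm (mom_h x))"
    by (rule square_integrable_imp_integrable[OF _ norm_mom_h_square_integrable]) measurable
  then show ?thesis by (rule integrable_norm_cancel) measurable
qed

lemma moment_map_nth: "moment_map dirichlet mom_h \<alpha> $ j = (\<integral>x. mom_h x $ j \<partial>dirichlet \<alpha>)"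
  unfolding moment_map_def
  by (rule integral_bounded_linear[OF bounded_linear_vec_nth mom_h_integrable, symmetric])

lemma moment_map_dirichlet:
  "moment_map dirichlet mom_h \<alpha> $ Inl i = \<alpha> $ i / (\<Sum>i\<in>UNIV. \<alpha> $ i)"
  "moment_map dirichlet mom_h \<alpha> $ Inr i
     = \<alpha> $ i * (\<alpha> $ i + 1) / ((\<Sum>i\<in>UNIV. \<alpha> $ i) * ((\<Sum>i\<in>UNIV. \<alpha> $ i) + 1))"
  unfolding moment_map_nth by (simp_all add: dirichlet_mean[OF k \<alpha>] dirichlet_second_moment[OF k \<alpha>])

lemma mom_g_at_moments:
  "(mom_g has_derivative (\<lambda>y. mom_G \<alpha> *v y)) (at (moment_map dirichlet mom_h \<alpha>))"
  "mom_g (moment_map dirichlet mom_h \<alpha>) = \<alpha>"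
  by (rule mom_g_has_derivative[OF dirichlet_params_bounds[OF k \<alpha>] moment_map_dirichlet])+

text \<open>
  The quadratic form of the asserted covariance matrix is the variance of the linearised estimator, which
  is the form in which \<open>delta_method\<close> asks for it; in particular the matrix is positive semidefinite.
\<close>

lemma mom_covariance_quadratic_form:
  "t \<bullet> ((mom_G \<alpha> ** covariance_matrix (dirichlet \<alpha>) mom_h ** transpose (mom_G \<alpha>)) *v t)
     = (\<integral>x. (t \<bullet> (mom_G \<alpha> *v (mom_h x - moment_map dirichlet mom_h \<alpha>)))\<^sup>2 \<partial>dirichlet \<alpha>)"
proof -
  have meas: "(\<lambda>x. mom_h x $ j) \<in> borel_measurable (dirichlet \<alpha>)" for j
    using vec_nth_borel_measurable[OF mom_h_measurable, of j]
    by (simp add: measurable_cong_sets[OF sets_dirichlet refl])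
  have adj: "(transpose (mom_G \<alpha>) *v t) \<bullet> z = t \<bullet> (mom_G \<alpha> *v z)" for z
    by (metis dot_lmul_matrix transpose_matrix_vector)
  show ?thesis
    unfolding inner_congruence
    by (subst covariance_quadratic_form[OF prob_space_axioms meas mom_h_square_integrable moment_map_nth])
      (simp only: adj)
qed

end

lemma moment_type_estimator_dirichlet:
  assumes k: "CARD('k::{finite,linorder}) \<ge> 2"
  shows "moment_type_estimator dirichlet (dirichlet_params :: (real ^ ('k::{finite,linorder})) set) mom_h mom_g moment_estimator"
proof -
  have left_inverse: "mom_g (moment_map dirichlet mom_h \<theta>) = \<theta>" if "\<theta> \<in> dirichlet_params" for \<theta> :: "real ^ ('k::{finite,linorder})"
    by (rule mom_g_at_moments(2)[OF k that])
  have inj: "inj_on (moment_map dirichlet mom_h) (dirichlet_params :: (real ^ ('k::{finite,linorder})) set)"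
    by (rule inj_on_inverseI[where g = mom_g]) (rule left_inverse)
  show ?thesis
    unfolding moment_type_estimator_def
    using inj by (auto simp: mom_h_integrable[OF k] left_inverse the_inv_into_f_f mom_g_sample_mean)
qed

lemma open_dirichlet_params: "open (dirichlet_params :: (real ^ 'n) set)"
proof -
  have "dirichlet_params = (\<Inter>i. {\<alpha> :: real ^ 'n. 0 < \<alpha> $ i})" by (auto simp: dirichlet_params_def)
  also have "open \<dots>"
    by (intro open_INT ballI open_Collect_less continuous_intros) auto
  finally show ?thesis .
qed

theorem proposition3p5:
  fixes \<alpha> :: "real ^ ('k::{finite,linorder})"
    and M :: "'a measure"
    and X :: "nat \<Rightarrow> 'a \<Rightarrow> real ^ ('k::{finite,linorder})"
  assumes "CARD('k) \<ge> 2"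
    and "\<alpha> \<in> dirichlet_params"
    and "random_sample M (dirichlet \<alpha>) X"
  shows "moment_type_estimator dirichlet (dirichlet_params :: (real ^ ('k::{finite,linorder})) set) mom_h mom_g moment_estimator
    \<and> asymptotic_covariance M X dirichlet_params moment_estimator \<alpha>
        (mom_G \<alpha> ** covariance_matrix (dirichlet \<alpha>) mom_h ** transpose (mom_G \<alpha>))"
proof
  show "moment_type_estimator dirichlet (dirichlet_params :: (real ^ ('k::{finite,linorder})) set) mom_h mom_g moment_estimator"
    by (rule moment_type_estimator_dirichlet[OF assms(1)])
next
  note k\<alpha> = assms(1,2)
  define m where "m = moment_map dirichlet mom_h \<alpha>"
  define H where "H n x = mom_h (X n x)" for n x
  define C where "C = mom_G \<alpha> ** covariance_matrix (dirichlet \<alpha>) mom_h ** transpose (mom_G \<alpha>)"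
  interpret prob_space M using assms(3) by (simp add: random_sample_def)
  have X: "indep_vars (\<lambda>_. borel) X {1..}" "\<And>n. n \<ge> 1 \<Longrightarrow> distr M borel (X n) = dirichlet \<alpha>"
    using assms(3) by (auto simp: random_sample_def)
  have X_meas: "X n \<in> borel_measurable M" if "n \<ge> 1" for n
    using X(1) that unfolding indep_vars_def2 by auto
  have X1: "distr M borel (X 1) = dirichlet \<alpha>" "X 1 \<in> borel_measurable M"
    by (rule X(2) X_meas, simp)+
  have transfer: "integrable M (\<lambda>x. f (X 1 x)) \<longleftrightarrow> integrable (dirichlet \<alpha>) f"
    "expectation (\<lambda>x. f (X 1 x)) = integral\<^sup>L (dirichlet \<alpha>) f"
    if "f \<in> borel_measurable borel" for f :: "real ^ ('k::{finite,linorder}) \<Rightarrow> 'c::{banach, second_countable_topology}"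
    using integrable_distr_eq[OF X1(2) that] integral_distr[OF X1(2) that] unfolding X1(1) by simp_all
  interpret iid_square_integrable M H "distr (dirichlet \<alpha>) borel mom_h" m
  proof
    show "indep_vars (\<lambda>_. borel) H {1..}"
      unfolding H_def by (rule indep_vars_compose2[OF X(1) mom_h_measurable])
    show "distr M borel (H n) = distr (dirichlet \<alpha>) borel mom_h" if "n \<ge> 1" for n
      unfolding H_def X(2)[OF that, symmetric]
      by (subst distr_distr[OF mom_h_measurable X_meas[OF that]]) (simp add: comp_def)
    show "integrable M (\<lambda>x. (norm (H 1 x))\<^sup>2)"
      unfolding H_def using transfer(1)[of "\<lambda>y. (norm (mom_h y))\<^sup>2"] mom_h_measurable
        norm_mom_h_square_integrable[OF k\<alpha>] by simp
    show "expectation (H 1) = m"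
      unfolding H_def m_def moment_map_def using transfer(2)[OF mom_h_measurable] by simp
  qed
  have g: "(mom_g has_derivative (\<lambda>y. mom_G \<alpha> *v y)) (at m)" and gm: "mom_g m = \<alpha>"
    unfolding m_def by (rule mom_g_at_moments[OF k\<alpha>])+
  have estimator: "moment_estimator N (\<lambda>n. X n \<omega>) = mom_g (sample_mean N (\<lambda>n. H n \<omega>))" for N \<omega>
    by (simp add: mom_g_sample_mean H_def)
  have quad: "t \<bullet> (C *v t) = expectation (\<lambda>x. (t \<bullet> (mom_G \<alpha> *v (H 1 x - m)))\<^sup>2)" for t
  proof -
    have "continuous_on UNIV (\<lambda>z. mom_G \<alpha> *v z)" by (simp add: linear_continuous_on)
    then have [measurable]: "(\<lambda>z. mom_G \<alpha> *v z) \<in> borel_measurable borel"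
      by (rule borel_measurable_continuous_onI)
    note mom_h_measurable [measurable]
    show ?thesis
      unfolding C_def mom_covariance_quadratic_form[OF k\<alpha>] H_def m_def
      by (rule transfer(2)[symmetric]) measurable
  qed
  have sym: "transpose C = C"
    unfolding C_def by (rule transpose_congruence[OF transpose_covariance_matrix])
  have "0 \<le> t \<bullet> (C *v t)" for t unfolding quad by simp
  from ex_centered_normal[OF sym this] obtain \<nu>
    where \<nu>: "centered_normal C \<nu>" "prob_space \<nu>" by blast
  have "converges_in_law (\<lambda>N. distr M borel (\<lambda>\<omega>. sqrt (real N) *\<^sub>R (mom_g (sample_mean N (\<lambda>n. H n \<omega>)) - mom_g m))) \<nu>"
    by (rule delta_method[OF mom_g_measurable g \<nu>(2)]) (use \<nu>(1) in \<open>auto simp: centered_normal_def quad\<close>)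
  moreover have "(\<lambda>N. prob {\<omega> \<in> space M. mom_g (sample_mean N (\<lambda>n. H n \<omega>)) \<in> dirichlet_params}) \<longlonglongrightarrow> 1"
    by (rule sample_mean_image_consistent[OF mom_g_measurable has_derivative_continuous[OF g] open_dirichlet_params])
      (simp add: gm assms(2))
  moreover have "(\<lambda>\<omega>. mom_g (sample_mean N (\<lambda>n. H n \<omega>))) \<in> borel_measurable M" for N
    using mom_g_measurable by measurable
  ultimately show "asymptotic_covariance M X dirichlet_params moment_estimator \<alpha>
        (mom_G \<alpha> ** covariance_matrix (dirichlet \<alpha>) mom_h ** transpose (mom_G \<alpha>))"
    unfolding asymptotic_covariance_def estimator Let_def C_def[symmetric] gm using \<nu>(1) by blast
qed

end
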